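(* Consider the $L$-layer LSTM described in the context and let $k\in\mathbb{Z}_{\ge0}$. For any initial states $s_1(0),s_2(0)$ with $s^{(l)}_1(0),s^{(l)}_2(0)\in\mathcal{S}^{(l)}(k)$ for all $l\in[L]$, any input sequence $x(0:t)\in[-x_{\max},x_{\max}]^{n_x\times(t+1)}$ and any integer $t>0$, $\|s^{(L)}(t,s_1(0),x(0:t))-s^{(L)}(t,s_2(0),x(0:t))\|\le\tilde\beta\big(\|s^{(1)}_1(0)-s^{(1)}_2(0)\|,\dots,\|s^{(L)}_1(0)-s^{(L)}_2(0)\|,t;k\big)$, where for nonnegative scalars $s^{(1)},\dots,s^{(L)}$, $\tilde\beta(s^{(1:L)},t;k)=\mu^{(L)}(t)\rho(A^{(L)}_s(k))^t s^{(L)}+\sum_{l=1}^{L-1}\mu^{(l:L)}(t)\frac{(t+L-l)!}{t!(L-l)!}\max_{i=l,\dots,L}\rho(A^{(i)}_s(k))^t\Big(\prod_{i=l+1}^L\|a^{(i)}_x(k)\|\Big)s^{(l)}$ (the sum being $0$ when $L=1$), with $\mu^{(l:L)}(t)=\prod_{i=l}^L\mu^{(i)}(t)$, $\mu^{(l)}(t)=\sqrt{(1+(r^{(l)})^{2t})+\frac{|\nu^{(l)}|^2}{|\lambda^{(l)}_1|^2}\Big(\frac{1-(r^{(l)})^t}{1-r^{(l)}}\Big)^2}$, where $A^{(l)}_s(k)=U\begin{bmatrix}\lambda^{(l)}_1&\nu^{(l)}\\0&\lambda^{(l)}_2\end{bmatrix}U^*$ is any decomposition with $U$ unitary and $\lambda^{(l)}_1\ge\lambda^{(l)}_2$,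 and $r^{(l)}=|\lambda^{(l)}_2|/|\lambda^{(l)}_1|\in[0,1]$.
   Context: LSTM: fix $L\in\mathbb{N}$, dimensions $n_x,n_c$, $x_{\max}>0$. For $l\in[L]$ let $n^{(l)}=n_x$ if $l=1$, $n^{(l)}=n_c$ if $l\ge2$; weights $W^{(l)}_*\in\mathbb{R}^{n_c\times n^{(l)}}$, $U^{(l)}_*\in\mathbb{R}^{n_c\times n_c}$, biases $b^{(l)}_*\in\mathbb{R}^{n_c}$, $*\in\{f,i,c,o\}$. With $\sigma(w)=1/(1+e^{-w})$, $\phi=\tanh$, $\odot$ componentwise product: $c^{(l)}(t+1)=\sigma(W^{(l)}_f x^{(l)}(t)+U^{(l)}_f h^{(l)}(t)+b^{(l)}_f)\odot c^{(l)}(t)+\sigma(W^{(l)}_i x^{(l)}(t)+U^{(l)}_i h^{(l)}(t)+b^{(l)}_i)\odot\phi(W^{(l)}_c x^{(l)}(t)+U^{(l)}_c h^{(l)}(t)+b^{(l)}_c)$, $h^{(l)}(t+1)=\sigma(W^{(l)}_o x^{(l)}(t)+U^{(l)}_o h^{(l)}(t)+b^{(l)}_o)\odot\phi(c^{(l)}(t+1))$, with $x^{(1)}(t)=x(t)$, $x^{(l)}(t)=h^{(l-1)}(t+1)$ for $l\ge2$. $s^{(l)}(t)=(c^{(l)}(t),h^{(l)}(t))$; $s^{(l)}(t,s(0),x(0:t))$ denotes the layer-$l$ state at time $t$ from initial state $s(0)=(s^{(1)}(0),\dots,s^{(L)}(0))$ under input $x$. Quantities: $x^{(l)}_{\max}=x_{\max}$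 if $l=1$, $=1$ if $l\ge2$; $|A|$ entrywise absolute value; $\mathbf{1}_n$ all-ones vector; $v_+$ componentwise positive part; $\|\cdot\|_\infty$ max norm. For $\eta\ge0$, $*\in\{f,i,o\}$: $G^{(l)}_*(\eta)=\|(x^{(l)}_{\max}|W^{(l)}_*|\mathbf{1}_{n^{(l)}}+\eta|U^{(l)}_*|\mathbf{1}_{n_c}+b^{(l)}_* )_+\|_\infty$, $G^{(l)}_c(\eta)=\|x^{(l)}_{\max}|W^{(l)}_c|\mathbf{1}_{n^{(l)}}+\eta|U^{(l)}_c|\mathbf{1}_{n_c}+|b^{(l)}_c|\|_\infty$. With $\eta^{(l)}(-1)=1$, $k\ge0$: $\overline{\sigma}^{(l)}_*(k)=\sigma(G^{(l)}_*(\eta^{(l)}(k-1)))$, $\overline{\phi}^{(l)}_c(k)=\phi(G^{(l)}_c(\eta^{(l)}(k-1)))$, $\overline{c}^{(l)}(k)=\overline{\sigma}^{(l)}_i(k)\overline{\phi}^{(l)}_c(k)/(1-\overline{\sigma}^{(l)}_f(k))$, $\eta^{(l)}(k)=\phi(\overline{c}^{(l)}(k))\overline{\sigma}^{(l)}_o(k)$. $\mathcal{S}^{(l)}(k)=\{(c,h):\|c\|_\infty\le\overline{c}^{(l)}(k),\|h\|_\infty\le\phi(\overline{c}^{(l)}(k))\overline{\sigma}^{(l)}_o(k)\}$. With $\|\cdot\|$ the Euclidean norm / induced 2-norm: $\alpha^{(l)}_s(k)=\tfrac14\|U^{(l)}_f\|\overline{c}^{(l)}(k)+\overline{\sigma}^{(l)}_i(k)\|U^{(l)}_c\|+\tfrac14\|U^{(l)}_i\|\overline{\phi}^{(l)}_c(k)$,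 $A^{(l)}_s(k)=\begin{bmatrix}\overline{\sigma}^{(l)}_f(k)&\alpha^{(l)}_s(k)\\ \overline{\sigma}^{(l)}_o(k)\overline{\sigma}^{(l)}_f(k)&\alpha^{(l)}_s(k)\overline{\sigma}^{(l)}_o(k)+\tfrac14\phi(\overline{c}^{(l)}(k))\|U^{(l)}_o\|\end{bmatrix}$; $\alpha^{(l)}_x(k)=\tfrac14\|W^{(l)}_f\|\overline{c}^{(l)}(k)+\overline{\sigma}^{(l)}_i(k)\|W^{(l)}_c\|+\tfrac14\|W^{(l)}_i\|\overline{\phi}^{(l)}_c(k)$, $a^{(l)}_x(k)=\big(\alpha^{(l)}_x(k),\ \alpha^{(l)}_x(k)\overline{\sigma}^{(l)}_o(k)+\tfrac14\phi(\overline{c}^{(l)}(k))\|W^{(l)}_o\|\big)^\top$; $\rho$ is spectral radius. *)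

theory Defs
  imports "HOL-Analysis.Analysis"
begin

section \<open>Multi-layer LSTM (Proposition 5.2 setting)\<close>

text \<open>Gates f, i, c, o.\<close>
datatype gate = Gf | Gi | Gc | Go

text \<open>Parameters of an L-layer LSTM.  Vectors in R^{n_x} are real^'x, vectors in R^{n_c}
 are real^'c.  Layer 1 input weights are Win, input weights of layers l >= 2 are Wh l,
 recurrent weights U l, biases b l (layers are indexed 1..L).\<close>
record ('x, 'c) lstm =
  Win :: "gate \<Rightarrow> real^'x^'c"
  Wh  :: "nat \<Rightarrow> gate \<Rightarrow> real^'c^'c"
  Uh  :: "nat \<Rightarrow> gate \<Rightarrow> real^'c^'c"
  bh  :: "nat \<Rightarrow> gate \<Rightarrow> real^'c"

definition sigm :: "real \<Rightarrow> real" where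
  "sigm w = 1 / (1 + exp (- w))"

type_synonym 'c lstate = "(real^'c) \<times> (real^'c)"  \<comment> \<open>(c, h)\<close>

text \<open>One LSTM cell update of layer l, given the input contributions wx g = W_g^{(l)} x^{(l)}(t).\<close>
definition cell :: "('x::finite, 'c::finite) lstm \<Rightarrow> nat \<Rightarrow> (gate \<Rightarrow> real^'c) \<Rightarrow> 'c lstate \<Rightarrow> 'c lstate" where
  "cell P l wx s =
     (let c = fst s; h = snd s;
          pre = (\<lambda>g. wx g + Uh P l g *v h + bh P l g);
          c' = (\<chi> j. sigm (pre Gf $ j) * c $ j + sigm (pre Gi $ j) * tanh (pre Gc $ j));
          h' = (\<chi> j. sigm (pre Go $ j) * tanh (c' $ j))
      in (c', h'))"

text \<open>States of all layers at time t+1 from the states at time t and input x(t).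
 Layer 1 receives x(t); layer l >= 2 receives h^{(l-1)}(t+1).\<close>
fun newst :: "('x::finite, 'c::finite) lstm \<Rightarrow> real^'x \<Rightarrow> (nat \<Rightarrow> 'c lstate) \<Rightarrow> nat \<Rightarrow> 'c lstate" where
  "newst P x s 0 = s 0"
| "newst P x s (Suc 0) = cell P 1 (\<lambda>g. Win P g *v x) (s 1)"
| "newst P x s (Suc (Suc l)) =
     cell P (Suc (Suc l)) (\<lambda>g. Wh P (Suc (Suc l)) g *v snd (newst P x s (Suc l))) (s (Suc (Suc l)))"

text \<open>traj P s0 x t l = s^{(l)}(t, s(0), x(0:t)).\<close>
fun traj :: "('x::finite, 'c::finite) lstm \<Rightarrow> (nat \<Rightarrow> 'c lstate) \<Rightarrow> (nat \<Rightarrow> real^'x) \<Rightarrow> nat \<Rightarrow> nat \<Rightarrow> 'c lstate" where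
  "traj P s0 x 0 = s0"
| "traj P s0 x (Suc t) = newst P (x t) (traj P s0 x t)"

section \<open>Bounds\<close>

definition ninf :: "real^'n::finite \<Rightarrow> real" where
  "ninf v = Max (range (\<lambda>i. \<bar>v $ i\<bar>))"

definition posp :: "real^'n::finite \<Rightarrow> real^'n" where
  "posp v = (\<chi> i. max 0 (v $ i))"

definition absrow :: "real^'m::finite^'n::finite \<Rightarrow> real^'n" where
  "absrow A = (\<chi> i. \<Sum>j\<in>UNIV. \<bar>A $ i $ j\<bar>)"   \<comment> \<open>|A| 1\<close>

definition vabs :: "real^'n::finite \<Rightarrow> real^'n" where
  "vabs v = (\<chi> i. \<bar>v $ i\<bar>)"

text \<open>x^{(l)}_max |W^{(l)}_g| 1 and ||W^{(l)}_g|| (induced 2-norm).\<close>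
definition Wrow :: "('x::finite, 'c::finite) lstm \<Rightarrow> real \<Rightarrow> nat \<Rightarrow> gate \<Rightarrow> real^'c" where
  "Wrow P xmax l g = (if l = 1 then xmax *\<^sub>R absrow (Win P g) else absrow (Wh P l g))"

definition Wnorm :: "('x::finite, 'c::finite) lstm \<Rightarrow> nat \<Rightarrow> gate \<Rightarrow> real" where
  "Wnorm P l g = (if l = 1 then onorm (\<lambda>v. Win P g *v v) else onorm (\<lambda>v. Wh P l g *v v))"

definition Unorm :: "('x::finite, 'c::finite) lstm \<Rightarrow> nat \<Rightarrow> gate \<Rightarrow> real" where
  "Unorm P l g = onorm (\<lambda>v. Uh P l g *v v)"

text \<open>G^{(l)}_g(eta) for g in {f,i,o} and G^{(l)}_c(eta).\<close>
definition Gs :: "('x::finite, 'c::finite) lstm \<Rightarrow> real \<Rightarrow> nat \<Rightarrow> gate \<Rightarrow> real \<Rightarrow> real" where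
  "Gs P xmax l g eta = ninf (posp (Wrow P xmax l g + eta *\<^sub>R absrow (Uh P l g) + bh P l g))"

definition Gcc :: "('x::finite, 'c::finite) lstm \<Rightarrow> real \<Rightarrow> nat \<Rightarrow> real \<Rightarrow> real" where
  "Gcc P xmax l eta = ninf (Wrow P xmax l Gc + eta *\<^sub>R absrow (Uh P l Gc) + vabs (bh P l Gc))"

text \<open>etap P xmax l k = eta^{(l)}(k-1); in particular etap ... 0 = eta^{(l)}(-1) = 1.\<close>
fun etap :: "('x::finite, 'c::finite) lstm \<Rightarrow> real \<Rightarrow> nat \<Rightarrow> nat \<Rightarrow> real" where
  "etap P xmax l 0 = 1"
| "etap P xmax l (Suc k) =
     (let e = etap P xmax l k;
          cb = sigm (Gs P xmax l Gi e) * tanh (Gcc P xmax l e) / (1 - sigm (Gs P xmax l Gf e))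
      in tanh cb * sigm (Gs P xmax l Go e))"

definition sigbar :: "('x::finite, 'c::finite) lstm \<Rightarrow> real \<Rightarrow> nat \<Rightarrow> gate \<Rightarrow> nat \<Rightarrow> real" where
  "sigbar P xmax l g k = sigm (Gs P xmax l g (etap P xmax l k))"

definition phibar :: "('x::finite, 'c::finite) lstm \<Rightarrow> real \<Rightarrow> nat \<Rightarrow> nat \<Rightarrow> real" where
  "phibar P xmax l k = tanh (Gcc P xmax l (etap P xmax l k))"

definition cbar :: "('x::finite, 'c::finite) lstm \<Rightarrow> real \<Rightarrow> nat \<Rightarrow> nat \<Rightarrow> real" where
  "cbar P xmax l k = sigbar P xmax l Gi k * phibar P xmax l k / (1 - sigbar P xmax l Gf k)"

definition Sset :: "('x::finite, 'c::finite) lstm \<Rightarrow> real \<Rightarrow> nat \<Rightarrow> nat \<Rightarrow> 'c lstate set" where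
  "Sset P xmax l k = {(c, h). ninf c \<le> cbar P xmax l k \<and>
                       ninf h \<le> tanh (cbar P xmax l k) * sigbar P xmax l Go k}"

definition mat2 :: "'a \<Rightarrow> 'a \<Rightarrow> 'a \<Rightarrow> 'a \<Rightarrow> 'a^2^2" where
  "mat2 a b c d = (\<chi> i j. if i = 1 then (if j = 1 then a else b) else (if j = 1 then c else d))"

definition alpha_s :: "('x::finite, 'c::finite) lstm \<Rightarrow> real \<Rightarrow> nat \<Rightarrow> nat \<Rightarrow> real" where
  "alpha_s P xmax l k = 1/4 * Unorm P l Gf * cbar P xmax l k + sigbar P xmax l Gi k * Unorm P l Gc
                        + 1/4 * Unorm P l Gi * phibar P xmax l k"

definition A_s :: "('x::finite, 'c::finite) lstm \<Rightarrow> real \<Rightarrow> nat \<Rightarrow> nat \<Rightarrow> real^2^2" where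
  "A_s P xmax l k = mat2 (sigbar P xmax l Gf k) (alpha_s P xmax l k)
      (sigbar P xmax l Go k * sigbar P xmax l Gf k)
      (alpha_s P xmax l k * sigbar P xmax l Go k + 1/4 * tanh (cbar P xmax l k) * Unorm P l Go)"

definition alpha_x :: "('x::finite, 'c::finite) lstm \<Rightarrow> real \<Rightarrow> nat \<Rightarrow> nat \<Rightarrow> real" where
  "alpha_x P xmax l k = 1/4 * Wnorm P l Gf * cbar P xmax l k + sigbar P xmax l Gi k * Wnorm P l Gc
                        + 1/4 * Wnorm P l Gi * phibar P xmax l k"

definition a_x :: "('x::finite, 'c::finite) lstm \<Rightarrow> real \<Rightarrow> nat \<Rightarrow> nat \<Rightarrow> real^2" where
  "a_x P xmax l k = (\<chi> i. if i = 1 then alpha_x P xmax l k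
      else alpha_x P xmax l k * sigbar P xmax l Go k + 1/4 * tanh (cbar P xmax l k) * Wnorm P l Go)"

section \<open>Spectral radius, unitary matrices\<close>

definition cmat :: "real^'n::finite^'m::finite \<Rightarrow> complex^'n^'m" where
  "cmat A = (\<chi> i j. complex_of_real (A $ i $ j))"

definition eigenvalues :: "complex^'n::finite^'n \<Rightarrow> complex set" where
  "eigenvalues A = {z. \<exists>v. v \<noteq> 0 \<and> A *v v = z *s v}"

definition spec_rad :: "real^'n::finite^'n \<Rightarrow> real" where
  "spec_rad A = Max (cmod ` eigenvalues (cmat A))"

definition cadj :: "complex^'n::finite^'m::finite \<Rightarrow> complex^'m^'n" where
  "cadj U = (\<chi> i j. cnj (U $ j $ i))"

definition unitary :: "complex^'n::finite^'n \<Rightarrow> bool" where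
  "unitary U \<longleftrightarrow> U ** cadj U = mat 1 \<and> cadj U ** U = mat 1"

text \<open>mu^{(l)}(t) for a Schur decomposition with data lam1, lam2, nu;
 the factor (1 - r^t)/(1 - r) is written as the geometric sum sum_{j<t} r^j.\<close>
definition mu :: "real \<Rightarrow> real \<Rightarrow> complex \<Rightarrow> nat \<Rightarrow> real" where
  "mu lam1 lam2 nu t =
     (let r = \<bar>lam2\<bar> / \<bar>lam1\<bar>
      in sqrt ((1 + r ^ (2 * t)) + (cmod nu)\<^sup>2 / \<bar>lam1\<bar>\<^sup>2 * (\<Sum>j<t. r ^ j)\<^sup>2))"

end

theory Submission
  imports Defs
begin

text \<open>
  On the invariant set \<open>\<S>(k)\<close> of a layer every gate is bounded by the constants \<open>\<sigma>(k)\<close> and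
  \<open>\<phi>\<^sub>c(k)\<close>, while \<open>\<sigma>\<close> and \<open>tanh\<close> are \<open>1/4\<close>- and \<open>1\<close>-Lipschitz. Hence the vector \<open>d(t)\<close> of the
  distances of the cell states and of the hidden states of layer \<open>l\<close> obeys the componentwise
  recursion \<open>d(t + 1) \<le> A\<^sub>s d(t) + e(t + 1) a\<^sub>x\<close>, where \<open>e\<close> is the state distance of layer \<open>l - 1\<close> and
  \<open>A\<^sub>s\<close> is nonnegative, so variation of constants bounds \<open>d(t)\<close> by powers of \<open>A\<^sub>s\<close>.
  From the Schur form \<open>A\<^sub>s = U T U\<^sup>*\<close> one gets \<open>\<parallel>A\<^sub>s\<^sup>s\<parallel> \<le> \<mu>(t) \<rho>(A\<^sub>s)\<^sup>s\<close> for all \<open>s \<le> t\<close>, which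
  reduces to an inequality between geometric sums. Unrolling through the layers gives nested
  convolution sums, and the hockey-stick identity turns their counting factors into the binomial
  coefficients of the bound.
\<close>

section \<open>Activation functions\<close>

lemma sigm_pos: "0 < sigm w"
  unfolding sigm_def by (simp add: add_pos_pos)

lemma sigm_less_1: "sigm w < 1"
  unfolding sigm_def by (simp add: add_pos_pos)

lemma sigm_nonneg: "0 \<le> sigm w"
  using sigm_pos less_imp_le by blast

lemma sigm_mono: "a \<le> b \<Longrightarrow> sigm a \<le> sigm b"
  unfolding sigm_def by (simp add: add_pos_pos frac_le)

lemma has_real_derivative_sigm: "(sigm has_real_derivative exp (- w) / (1 + exp (- w))\<^sup>2) (at w)"
proof -
  have "1 + exp (- w) \<noteq> 0"
    by (metis add_pos_pos exp_gt_zero less_irrefl zero_less_one)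
  then have "((\<lambda>w. 1 / (1 + exp (- w))) has_real_derivative exp (- w) / (1 + exp (- w))\<^sup>2) (at w)"
    by (auto intro!: derivative_eq_intros simp: power2_eq_square)
  then show ?thesis
    by (simp add: sigm_def [abs_def])
qed

lemma sigm_derivative_le: "exp (- w) / (1 + exp (- w))\<^sup>2 \<le> (1 / 4 :: real)"
proof -
  have "4 * exp (- w) \<le> (1 + exp (- w))\<^sup>2"
    using zero_le_power2 [of "1 - exp (- w)"] by (simp add: power2_eq_square algebra_simps)
  moreover have "0 < 1 + exp (- w)"
    by (simp add: add_pos_pos)
  ultimately show ?thesis
    by (simp add: field_simps)
qed

lemma sigm_lipschitz: "\<bar>sigm a - sigm b\<bar> \<le> 1 / 4 * \<bar>a - b\<bar>"
  using field_differentiable_bound [of UNIV sigm "\<lambda>w. exp (- w) / (1 + exp (- w))\<^sup>2" "1 / 4" a b]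
    has_real_derivative_sigm sigm_derivative_le
  by auto

lemma tanh_lipschitz: "\<bar>tanh a - tanh b\<bar> \<le> \<bar>a - b :: real\<bar>"
proof -
  have "\<bar>1 - (tanh w)\<^sup>2\<bar> \<le> 1" for w :: real
    using tanh_real_bounds [of w] by (simp add: abs_square_le_1 abs_le_iff)
  moreover have "(tanh has_real_derivative 1 - (tanh w)\<^sup>2) (at w)" for w :: real
    by (auto intro!: derivative_eq_intros)
  ultimately show ?thesis
    using field_differentiable_bound [of UNIV tanh "\<lambda>w. 1 - (tanh w)\<^sup>2" 1 a b] by auto
qed

lemma abs_tanh_le: "\<bar>a\<bar> \<le> b \<Longrightarrow> \<bar>tanh a\<bar> \<le> tanh (b :: real)"
  by (metis tanh_real_abs tanh_real_le_iff)

section \<open>Gate bounds and the invariant sets\<close>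

lemma abs_component_le_ninf: "\<bar>v $ j\<bar> \<le> ninf v"
  unfolding ninf_def by (rule Max_ge) auto

lemma ninf_leI: "(\<And>j. \<bar>v $ j\<bar> \<le> B) \<Longrightarrow> ninf v \<le> B"
  unfolding ninf_def by (subst Max_le_iff) auto

lemma ninf_nonneg: "0 \<le> ninf v"
  using abs_component_le_ninf [of v] abs_ge_zero order_trans by blast

lemma ninf_mono: "(\<And>j. \<bar>v $ j\<bar> \<le> \<bar>w $ j\<bar>) \<Longrightarrow> ninf v \<le> ninf w"
  by (rule ninf_leI) (meson abs_component_le_ninf order_trans)

lemma absrow_nonneg: "0 \<le> absrow A $ j"
  unfolding absrow_def by (simp add: sum_nonneg)

lemma abs_matrix_vector_le_absrow:
  assumes "\<And>m. \<bar>h $ m\<bar> \<le> e"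
  shows "\<bar>(A *v h) $ j\<bar> \<le> e * absrow A $ j"
proof -
  have "\<bar>(A *v h) $ j\<bar> = \<bar>\<Sum>m\<in>UNIV. A $ j $ m * h $ m\<bar>"
    by (simp add: matrix_vector_mult_def)
  also have "\<dots> \<le> (\<Sum>m\<in>UNIV. \<bar>A $ j $ m\<bar> * e)"
    by (rule order_trans [OF sum_abs]) (auto intro!: sum_mono mult_left_mono simp: abs_mult assms)
  also have "\<dots> = e * absrow A $ j"
    unfolding absrow_def by (simp add: sum_distrib_left mult.commute)
  finally show ?thesis .
qed

lemma Wrow_nonneg: "0 \<le> xmax \<Longrightarrow> 0 \<le> Wrow P xmax l g $ j"
  unfolding Wrow_def by (simp add: absrow_nonneg)

lemma Gs_mono: "e \<le> e' \<Longrightarrow> Gs P xmax l g e \<le> Gs P xmax l g e'"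
  unfolding Gs_def posp_def
  using mult_right_mono [OF _ absrow_nonneg, of e e' "Uh P l g"]
  by (intro ninf_mono) (fastforce simp: max_def)

lemma Gcc_mono: "0 \<le> xmax \<Longrightarrow> 0 \<le> e \<Longrightarrow> e \<le> e' \<Longrightarrow> Gcc P xmax l e \<le> Gcc P xmax l e'"
  unfolding Gcc_def vabs_def
  using Wrow_nonneg [of xmax P l Gc] absrow_nonneg [of "Uh P l Gc"]
  by (intro ninf_mono) (auto intro!: mult_right_mono add_nonneg_nonneg)

lemma Gcc_nonneg: "0 \<le> Gcc P xmax l e"
  unfolding Gcc_def by (rule ninf_nonneg)

lemma preactivation_le_Gs:
  assumes "\<And>j. \<bar>wx $ j\<bar> \<le> Wrow P xmax l g $ j" and "\<And>m. \<bar>h $ m\<bar> \<le> e"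
  shows "(wx + Uh P l g *v h + bh P l g) $ j \<le> Gs P xmax l g e"
proof -
  have "(wx + Uh P l g *v h + bh P l g) $ j \<le> (Wrow P xmax l g + e *\<^sub>R absrow (Uh P l g) + bh P l g) $ j"
    using assms(1) [of j] abs_matrix_vector_le_absrow [OF assms(2), of "Uh P l g" j] by simp
  also have "\<dots> \<le> \<bar>posp (Wrow P xmax l g + e *\<^sub>R absrow (Uh P l g) + bh P l g) $ j\<bar>"
    unfolding posp_def by simp
  also have "\<dots> \<le> Gs P xmax l g e"
    unfolding Gs_def by (rule abs_component_le_ninf)
  finally show ?thesis .
qed

lemma abs_preactivation_le_Gcc:
  assumes "\<And>j. \<bar>wx $ j\<bar> \<le> Wrow P xmax l Gc $ j" and "\<And>m. \<bar>h $ m\<bar> \<le> e"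
  shows "\<bar>(wx + Uh P l Gc *v h + bh P l Gc) $ j\<bar> \<le> Gcc P xmax l e"
proof -
  have "\<bar>(wx + Uh P l Gc *v h + bh P l Gc) $ j\<bar> \<le> \<bar>wx $ j\<bar> + \<bar>(Uh P l Gc *v h) $ j\<bar> + \<bar>bh P l Gc $ j\<bar>"
    by (simp add: order_trans [OF abs_triangle_ineq])
  also have "\<dots> \<le> \<bar>(Wrow P xmax l Gc + e *\<^sub>R absrow (Uh P l Gc) + vabs (bh P l Gc)) $ j\<bar>"
    using assms(1) [of j] abs_matrix_vector_le_absrow [OF assms(2), of "Uh P l Gc" j]
    by (simp add: vabs_def)
  also have "\<dots> \<le> Gcc P xmax l e"
    unfolding Gcc_def by (rule abs_component_le_ninf)
  finally show ?thesis .
qed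

lemma sigbar_pos: "0 < sigbar P xmax l g k"
  unfolding sigbar_def by (rule sigm_pos)

lemma sigbar_less_1: "sigbar P xmax l g k < 1"
  unfolding sigbar_def by (rule sigm_less_1)

lemma sigbar_nonneg: "0 \<le> sigbar P xmax l g k"
  using sigbar_pos less_imp_le by blast

lemma phibar_nonneg: "0 \<le> phibar P xmax l k"
  unfolding phibar_def using Gcc_nonneg by simp

lemma cbar_nonneg: "0 \<le> cbar P xmax l k"
  unfolding cbar_def
  using sigbar_pos [of P xmax l Gi k] sigbar_less_1 [of P xmax l Gf k] phibar_nonneg [of P xmax l k]
  by simp

lemma tanh_cbar_nonneg: "0 \<le> tanh (cbar P xmax l k)"
  using cbar_nonneg by simp

lemma cbar_fixpoint:
  "sigbar P xmax l Gf k * cbar P xmax l k + sigbar P xmax l Gi k * phibar P xmax l k = cbar P xmax l k"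
  using sigbar_less_1 [of P xmax l Gf k] unfolding cbar_def by (simp add: field_simps)

definition eta_step :: "('x::finite, 'c::finite) lstm \<Rightarrow> real \<Rightarrow> nat \<Rightarrow> real \<Rightarrow> real" where
  "eta_step P xmax l e =
     tanh (sigm (Gs P xmax l Gi e) * tanh (Gcc P xmax l e) / (1 - sigm (Gs P xmax l Gf e)))
     * sigm (Gs P xmax l Go e)"

lemma etap_Suc_eta_step: "etap P xmax l (Suc k) = eta_step P xmax l (etap P xmax l k)"
  by (simp only: etap.simps eta_step_def Let_def)

lemma etap_Suc_eq: "etap P xmax l (Suc k) = tanh (cbar P xmax l k) * sigbar P xmax l Go k"
  by (simp add: cbar_def sigbar_def phibar_def Let_def)

lemma etap_nonneg: "0 \<le> etap P xmax l k"
proof (cases k)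
  case (Suc m)
  then show ?thesis
    using etap_Suc_eq [of P xmax l m] tanh_cbar_nonneg [of P xmax l m] sigbar_nonneg [of P xmax l Go m]
    by simp
qed simp

lemma etap_le_1: "etap P xmax l k \<le> 1"
proof (cases k)
  case (Suc m)
  have "tanh (cbar P xmax l m) * sigbar P xmax l Go m \<le> 1 * 1"
    using tanh_real_bounds [of "cbar P xmax l m"] tanh_cbar_nonneg less_imp_le [OF sigbar_less_1]
    by (intro mult_mono) (auto simp: sigbar_nonneg)
  then show ?thesis
    by (simp only: Suc etap_Suc_eq mult_1)
qed simp

lemma eta_step_mono:
  assumes "0 \<le> xmax" "0 \<le> e" "e \<le> e'"
  shows "eta_step P xmax l e \<le> eta_step P xmax l e'"
proof -
  have gate: "sigm (Gs P xmax l g e) \<le> sigm (Gs P xmax l g e')" for g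
    using assms by (intro sigm_mono Gs_mono)
  have cand: "tanh (Gcc P xmax l e) \<le> tanh (Gcc P xmax l e')"
    using assms by (simp add: Gcc_mono)
  have "sigm (Gs P xmax l Gi e) * tanh (Gcc P xmax l e) / (1 - sigm (Gs P xmax l Gf e))
      \<le> sigm (Gs P xmax l Gi e') * tanh (Gcc P xmax l e') / (1 - sigm (Gs P xmax l Gf e'))"
    using gate [of Gi] gate [of Gf] cand sigm_less_1 [of "Gs P xmax l Gf e'"]
    by (intro frac_le mult_mono) (auto simp: sigm_nonneg Gcc_nonneg)
  moreover have "0 \<le> sigm (Gs P xmax l Gi e) * tanh (Gcc P xmax l e) / (1 - sigm (Gs P xmax l Gf e))"
    using sigm_less_1 [of "Gs P xmax l Gf e"] by (simp add: sigm_nonneg Gcc_nonneg)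
  ultimately show ?thesis
    unfolding eta_step_def using gate [of Go] by (intro mult_mono) (auto simp: sigm_nonneg)
qed

lemma etap_Suc_le: "0 \<le> xmax \<Longrightarrow> etap P xmax l (Suc k) \<le> etap P xmax l k"
proof (induction k)
  case 0
  then show ?case using etap_le_1 [of P xmax l 1] by simp
next
  case (Suc k)
  have "eta_step P xmax l (etap P xmax l (Suc k)) \<le> eta_step P xmax l (etap P xmax l k)"
    using Suc by (intro eta_step_mono etap_nonneg)
  then show ?case
    by (simp only: etap_Suc_eta_step)
qed

definition preact :: "('x::finite, 'c::finite) lstm \<Rightarrow> nat \<Rightarrow> (gate \<Rightarrow> real^'c) \<Rightarrow> real^'c \<Rightarrow> gate \<Rightarrow> real^'c"
  where "preact P l wx h g = wx g + Uh P l g *v h + bh P l g"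

lemma cell_fst_component:
  "fst (cell P l wx s) $ j =
     sigm (preact P l wx (snd s) Gf $ j) * fst s $ j
     + sigm (preact P l wx (snd s) Gi $ j) * tanh (preact P l wx (snd s) Gc $ j)"
  by (simp add: cell_def preact_def Let_def)

lemma cell_snd_component:
  "snd (cell P l wx s) $ j = sigm (preact P l wx (snd s) Go $ j) * tanh (fst (cell P l wx s) $ j)"
  by (simp add: cell_def preact_def Let_def)

lemma abs_cell_snd_le_1: "\<bar>snd (cell P l wx s) $ j\<bar> \<le> 1"
proof -
  have "\<bar>snd (cell P l wx s) $ j\<bar> \<le> 1 * 1"
    unfolding cell_snd_component abs_mult
    using sigm_nonneg less_imp_le [OF sigm_less_1] tanh_real_bounds
    by (intro mult_mono) (auto simp: abs_le_iff less_imp_le)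
  then show ?thesis by simp
qed

text \<open>A state in \<open>\<S>(k)\<close> has \<open>\<parallel>h\<parallel>\<^sub>\<infinity> \<le> \<eta>(k) \<le> \<eta>(k - 1)\<close>, which is the hidden-state
  bound that enters the gate bounds \<open>\<sigma>\<^sub>*(k)\<close>, \<open>\<phi>\<^sub>c(k)\<close>.\<close>

lemma Sset_bounds:
  assumes "s \<in> Sset P xmax l k" "0 \<le> xmax"
  shows "\<And>j. \<bar>fst s $ j\<bar> \<le> cbar P xmax l k" and "\<And>j. \<bar>snd s $ j\<bar> \<le> etap P xmax l k"
proof -
  show "\<bar>fst s $ j\<bar> \<le> cbar P xmax l k" for j
    using assms unfolding Sset_def by (auto intro: order_trans [OF abs_component_le_ninf])
  fix j
  have "\<bar>snd s $ j\<bar> \<le> etap P xmax l (Suc k)"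
    using assms unfolding Sset_def etap_Suc_eq by (auto intro: order_trans [OF abs_component_le_ninf])
  then show "\<bar>snd s $ j\<bar> \<le> etap P xmax l k"
    using etap_Suc_le [OF assms(2), of P l k] by linarith
qed

lemma
  assumes "\<And>g j. \<bar>wx g $ j\<bar> \<le> Wrow P xmax l g $ j" and "\<And>m. \<bar>h $ m\<bar> \<le> etap P xmax l k"
  shows gate_le_sigbar: "sigm (preact P l wx h g $ j) \<le> sigbar P xmax l g k"
    and abs_candidate_le_phibar: "\<bar>tanh (preact P l wx h Gc $ j)\<bar> \<le> phibar P xmax l k"
  unfolding sigbar_def phibar_def preact_def
  using assms preactivation_le_Gs abs_preactivation_le_Gcc
  by (metis sigm_mono, metis abs_tanh_le)

lemma cell_in_Sset:
  assumes "0 \<le> xmax" and s: "s \<in> Sset P xmax l k"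
    and wx: "\<And>g j. \<bar>wx g $ j\<bar> \<le> Wrow P xmax l g $ j"
  shows "cell P l wx s \<in> Sset P xmax l k"
proof -
  note c_bound = Sset_bounds(1) [OF s assms(1)] and h_bound = Sset_bounds(2) [OF s assms(1)]
  note gate = gate_le_sigbar [OF wx h_bound] and cand = abs_candidate_le_phibar [OF wx h_bound]
  have c: "\<bar>fst (cell P l wx s) $ j\<bar> \<le> cbar P xmax l k" for j
  proof -
    have "\<bar>fst (cell P l wx s) $ j\<bar>
        \<le> sigbar P xmax l Gf k * cbar P xmax l k + sigbar P xmax l Gi k * phibar P xmax l k"
      unfolding cell_fst_component
      by (rule order_trans [OF abs_triangle_ineq], unfold abs_mult, intro add_mono mult_mono)
        (use gate cand c_bound sigm_nonneg sigbar_nonneg cbar_nonneg in auto)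
    then show ?thesis
      by (simp only: cbar_fixpoint)
  qed
  have h: "\<bar>snd (cell P l wx s) $ j\<bar> \<le> tanh (cbar P xmax l k) * sigbar P xmax l Go k" for j
    unfolding cell_snd_component abs_mult mult.commute [of "tanh _"]
    using gate c [of j] abs_tanh_le
    by (intro mult_mono) (auto simp: sigbar_nonneg abs_of_nonneg [OF sigm_nonneg])
  show ?thesis
    unfolding Sset_def using ninf_leI [OF c] ninf_leI [OF h] by (cases "cell P l wx s") auto
qed

section \<open>Lipschitz bound of one cell\<close>

lemma abs_mult_diff_le:
  fixes a1 a2 x1 x2 :: real
  assumes "0 \<le> a1" "a1 \<le> A" "\<bar>x2\<bar> \<le> X"
  shows "\<bar>a1 * x1 - a2 * x2\<bar> \<le> A * \<bar>x1 - x2\<bar> + \<bar>a1 - a2\<bar> * X"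
proof -
  have "\<bar>a1 * x1 - a2 * x2\<bar> = \<bar>a1 * (x1 - x2) + (a1 - a2) * x2\<bar>"
    by (simp add: algebra_simps)
  also have "\<dots> \<le> \<bar>a1\<bar> * \<bar>x1 - x2\<bar> + \<bar>a1 - a2\<bar> * \<bar>x2\<bar>"
    by (metis abs_mult abs_triangle_ineq)
  also have "\<dots> \<le> A * \<bar>x1 - x2\<bar> + \<bar>a1 - a2\<bar> * X"
    using assms by (intro add_mono mult_mono) auto
  finally show ?thesis .
qed

lemma norm_vabs: "norm (vabs y) = norm y"
  by (simp add: norm_vec_def vabs_def)

lemma norm_le_of_abs_le: "(\<And>j. \<bar>x $ j\<bar> \<le> z $ j) \<Longrightarrow> norm x \<le> norm (z :: real^'n::finite)"
  by (rule norm_le_componentwise_cart) (metis abs_ge_self order_trans real_norm_def)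

lemma norm_matrix_vector_le_onorm: "norm ((A::real^'n::finite^'m::finite) *v v) \<le> onorm ((*v) A) * norm v"
  using onorm [OF matrix_vector_mul_bounded_linear [of A]] by simp

lemma onorm_matrix_vector_nonneg: "0 \<le> onorm ((*v) (A::real^'n::finite^'m::finite))"
  using onorm_pos_le [OF matrix_vector_mul_bounded_linear [of A]] by simp

lemma Unorm_nonneg: "0 \<le> Unorm P l g"
  unfolding Unorm_def by (rule onorm_matrix_vector_nonneg)

lemma Wnorm_nonneg: "0 \<le> Wnorm P l g"
  unfolding Wnorm_def by (simp add: onorm_matrix_vector_nonneg)

context
  fixes P :: "('x::finite, 'c::finite) lstm" and xmax d :: real and l k :: nat
    and wx1 wx2 :: "gate \<Rightarrow> real^'c" and s1 s2 :: "'c lstate"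
  assumes xmax: "0 \<le> xmax" and s1: "s1 \<in> Sset P xmax l k" and s2: "s2 \<in> Sset P xmax l k"
    and wx1: "\<And>g j. \<bar>wx1 g $ j\<bar> \<le> Wrow P xmax l g $ j"
    and wx2: "\<And>g j. \<bar>wx2 g $ j\<bar> \<le> Wrow P xmax l g $ j"
    and wx_dist: "\<And>g. norm (wx1 g - wx2 g) \<le> Wnorm P l g * d"
begin

lemma norm_preact_diff_le:
  "norm (preact P l wx1 (snd s1) g - preact P l wx2 (snd s2) g)
     \<le> Wnorm P l g * d + Unorm P l g * norm (snd s1 - snd s2)"
proof -
  have "preact P l wx1 (snd s1) g - preact P l wx2 (snd s2) g = (wx1 g - wx2 g) + Uh P l g *v (snd s1 - snd s2)"
    unfolding preact_def by (simp add: matrix_vector_mult_diff_distrib algebra_simps)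
  then show ?thesis
    unfolding Unorm_def
    by (metis add_mono norm_matrix_vector_le_onorm norm_triangle_le wx_dist)
qed

lemma abs_cell_fst_diff_le:
  defines "dp g \<equiv> preact P l wx1 (snd s1) g - preact P l wx2 (snd s2) g"
  shows "\<bar>(fst (cell P l wx1 s1) - fst (cell P l wx2 s2)) $ j\<bar>
    \<le> sigbar P xmax l Gf k * \<bar>(fst s1 - fst s2) $ j\<bar> + cbar P xmax l k / 4 * \<bar>dp Gf $ j\<bar>
      + sigbar P xmax l Gi k * \<bar>dp Gc $ j\<bar> + phibar P xmax l k / 4 * \<bar>dp Gi $ j\<bar>"
proof -
  define p1 where "p1 g = preact P l wx1 (snd s1) g $ j" for g
  define p2 where "p2 g = preact P l wx2 (snd s2) g $ j" for g
  note gate1 = gate_le_sigbar [OF wx1 Sset_bounds(2) [OF s1 xmax]]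
  note cand2 = abs_candidate_le_phibar [OF wx2 Sset_bounds(2) [OF s2 xmax]]
  have forget: "\<bar>sigm (p1 Gf) * fst s1 $ j - sigm (p2 Gf) * fst s2 $ j\<bar>
      \<le> sigbar P xmax l Gf k * \<bar>fst s1 $ j - fst s2 $ j\<bar> + cbar P xmax l k / 4 * \<bar>p1 Gf - p2 Gf\<bar>"
  proof -
    have "\<bar>sigm (p1 Gf) * fst s1 $ j - sigm (p2 Gf) * fst s2 $ j\<bar>
        \<le> sigbar P xmax l Gf k * \<bar>fst s1 $ j - fst s2 $ j\<bar> + \<bar>sigm (p1 Gf) - sigm (p2 Gf)\<bar> * cbar P xmax l k"
      by (rule abs_mult_diff_le) (use gate1 Sset_bounds(1) [OF s2 xmax] in \<open>auto simp: sigm_nonneg p1_def\<close>)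
    then show ?thesis
      using mult_right_mono [OF sigm_lipschitz [of "p1 Gf" "p2 Gf"] cbar_nonneg [of P xmax l k]]
      by (simp add: field_simps)
  qed
  have input: "\<bar>sigm (p1 Gi) * tanh (p1 Gc) - sigm (p2 Gi) * tanh (p2 Gc)\<bar>
      \<le> sigbar P xmax l Gi k * \<bar>p1 Gc - p2 Gc\<bar> + phibar P xmax l k / 4 * \<bar>p1 Gi - p2 Gi\<bar>"
  proof -
    have "\<bar>sigm (p1 Gi) * tanh (p1 Gc) - sigm (p2 Gi) * tanh (p2 Gc)\<bar>
        \<le> sigbar P xmax l Gi k * \<bar>tanh (p1 Gc) - tanh (p2 Gc)\<bar> + \<bar>sigm (p1 Gi) - sigm (p2 Gi)\<bar> * phibar P xmax l k"
      by (rule abs_mult_diff_le) (use gate1 cand2 in \<open>auto simp: sigm_nonneg p1_def p2_def\<close>)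
    then show ?thesis
      using mult_right_mono [OF sigm_lipschitz [of "p1 Gi" "p2 Gi"] phibar_nonneg [of P xmax l k]]
        mult_left_mono [OF tanh_lipschitz [of "p1 Gc" "p2 Gc"] sigbar_nonneg [of P xmax l Gi k]]
      by (simp add: field_simps)
  qed
  show ?thesis
    using abs_triangle_ineq forget input
    unfolding vector_minus_component cell_fst_component dp_def p1_def p2_def
    by (smt (verit))
qed

lemma norm_cell_fst_diff_le:
  "norm (fst (cell P l wx1 s1) - fst (cell P l wx2 s2))
     \<le> sigbar P xmax l Gf k * norm (fst s1 - fst s2) + alpha_s P xmax l k * norm (snd s1 - snd s2)
       + alpha_x P xmax l k * d"
proof -
  define dp where "dp g = preact P l wx1 (snd s1) g - preact P l wx2 (snd s2) g" for g
  have "norm (fst (cell P l wx1 s1) - fst (cell P l wx2 s2))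
      \<le> norm (sigbar P xmax l Gf k *\<^sub>R vabs (fst s1 - fst s2) + (cbar P xmax l k / 4) *\<^sub>R vabs (dp Gf)
          + sigbar P xmax l Gi k *\<^sub>R vabs (dp Gc) + (phibar P xmax l k / 4) *\<^sub>R vabs (dp Gi))"
    using abs_cell_fst_diff_le by (intro norm_le_of_abs_le) (simp add: vabs_def dp_def)
  also have "\<dots> \<le> sigbar P xmax l Gf k * norm (fst s1 - fst s2) + cbar P xmax l k / 4 * norm (dp Gf)
      + sigbar P xmax l Gi k * norm (dp Gc) + phibar P xmax l k / 4 * norm (dp Gi)"
    by (intro norm_triangle_le add_mono) (simp_all add: norm_vabs sigbar_nonneg cbar_nonneg phibar_nonneg)
  also have "\<dots> \<le> sigbar P xmax l Gf k * norm (fst s1 - fst s2)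
      + cbar P xmax l k / 4 * (Wnorm P l Gf * d + Unorm P l Gf * norm (snd s1 - snd s2))
      + sigbar P xmax l Gi k * (Wnorm P l Gc * d + Unorm P l Gc * norm (snd s1 - snd s2))
      + phibar P xmax l k / 4 * (Wnorm P l Gi * d + Unorm P l Gi * norm (snd s1 - snd s2))"
    unfolding dp_def
    by (intro add_mono mult_left_mono norm_preact_diff_le order_refl)
      (simp_all add: sigbar_nonneg cbar_nonneg phibar_nonneg)
  also have "\<dots> = sigbar P xmax l Gf k * norm (fst s1 - fst s2) + alpha_s P xmax l k * norm (snd s1 - snd s2)
       + alpha_x P xmax l k * d"
    unfolding alpha_s_def alpha_x_def by (simp add: algebra_simps)
  finally show ?thesis .
qed

lemma abs_cell_snd_diff_le:
  "\<bar>(snd (cell P l wx1 s1) - snd (cell P l wx2 s2)) $ j\<bar>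
    \<le> sigbar P xmax l Go k * \<bar>(fst (cell P l wx1 s1) - fst (cell P l wx2 s2)) $ j\<bar>
      + tanh (cbar P xmax l k) / 4 * \<bar>(preact P l wx1 (snd s1) Go - preact P l wx2 (snd s2) Go) $ j\<bar>"
proof -
  define p1 where "p1 = preact P l wx1 (snd s1) Go $ j"
  define p2 where "p2 = preact P l wx2 (snd s2) Go $ j"
  define c1 where "c1 = fst (cell P l wx1 s1) $ j"
  define c2 where "c2 = fst (cell P l wx2 s2) $ j"
  have "\<bar>c2\<bar> \<le> cbar P xmax l k"
    unfolding c2_def using Sset_bounds(1) [OF cell_in_Sset [OF xmax s2 wx2] xmax] .
  then have "\<bar>sigm p1 * tanh c1 - sigm p2 * tanh c2\<bar>
      \<le> sigbar P xmax l Go k * \<bar>tanh c1 - tanh c2\<bar> + \<bar>sigm p1 - sigm p2\<bar> * tanh (cbar P xmax l k)"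
    using gate_le_sigbar [OF wx1 Sset_bounds(2) [OF s1 xmax]]
    by (intro abs_mult_diff_le) (auto simp: sigm_nonneg p1_def abs_tanh_le)
  then show ?thesis
    using mult_right_mono [OF sigm_lipschitz [of p1 p2] tanh_cbar_nonneg [of P xmax l k]]
      mult_left_mono [OF tanh_lipschitz [of c1 c2] sigbar_nonneg [of P xmax l Go k]]
    unfolding vector_minus_component cell_snd_component [of P l wx1] cell_snd_component [of P l wx2]
      p1_def p2_def c1_def c2_def
    by (simp add: field_simps)
qed

lemma norm_cell_snd_diff_le:
  "norm (snd (cell P l wx1 s1) - snd (cell P l wx2 s2))
     \<le> sigbar P xmax l Go k * sigbar P xmax l Gf k * norm (fst s1 - fst s2)
       + (alpha_s P xmax l k * sigbar P xmax l Go k + 1/4 * tanh (cbar P xmax l k) * Unorm P l Go)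
         * norm (snd s1 - snd s2)
       + (alpha_x P xmax l k * sigbar P xmax l Go k + 1/4 * tanh (cbar P xmax l k) * Wnorm P l Go) * d"
proof -
  define dp where "dp = preact P l wx1 (snd s1) Go - preact P l wx2 (snd s2) Go"
  have "norm (snd (cell P l wx1 s1) - snd (cell P l wx2 s2))
      \<le> norm (sigbar P xmax l Go k *\<^sub>R vabs (fst (cell P l wx1 s1) - fst (cell P l wx2 s2))
          + (tanh (cbar P xmax l k) / 4) *\<^sub>R vabs dp)"
    using abs_cell_snd_diff_le by (intro norm_le_of_abs_le) (simp add: vabs_def dp_def)
  also have "\<dots> \<le> sigbar P xmax l Go k * norm (fst (cell P l wx1 s1) - fst (cell P l wx2 s2))
      + tanh (cbar P xmax l k) / 4 * norm dp"
    by (intro norm_triangle_le add_mono) (simp_all add: norm_vabs sigbar_nonneg abs_of_nonneg [OF tanh_cbar_nonneg])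
  also have "\<dots> \<le> sigbar P xmax l Go k * (sigbar P xmax l Gf k * norm (fst s1 - fst s2)
        + alpha_s P xmax l k * norm (snd s1 - snd s2) + alpha_x P xmax l k * d)
      + tanh (cbar P xmax l k) / 4 * (Wnorm P l Go * d + Unorm P l Go * norm (snd s1 - snd s2))"
    unfolding dp_def
    by (intro add_mono mult_left_mono norm_cell_fst_diff_le norm_preact_diff_le)
      (simp_all add: sigbar_nonneg cbar_nonneg)
  finally show ?thesis
    by (simp add: algebra_simps)
qed

end

section \<open>Nonnegative linear recursions\<close>

lemma matrix_vector_mono:
  assumes "\<And>i j. 0 \<le> (A::real^'n::finite^'m::finite) $ i $ j" and "\<And>i. x $ i \<le> y $ i"
  shows "(A *v x) $ i \<le> (A *v y) $ i"
  unfolding matrix_vector_mult_def using assms by (auto intro!: sum_mono mult_left_mono)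

lemma matrix_vector_mult_sum: "(A::real^'n::finite^'m::finite) *v (\<Sum>\<sigma>\<in>S. f \<sigma>) = (\<Sum>\<sigma>\<in>S. A *v f \<sigma>)"
  using linear_sum [OF matrix_vector_mul_linear [of A], of f S] by (simp add: o_def)

lemma componentwise_recursion_le:
  fixes A :: "real^'n::finite^'n" and v :: "nat \<Rightarrow> real^'n" and w :: "nat \<Rightarrow> real"
  assumes A: "\<And>i j. 0 \<le> A $ i $ j"
    and step: "\<And>\<tau> i. \<tau> < T \<Longrightarrow> v (Suc \<tau>) $ i \<le> (A *v v \<tau> + w (Suc \<tau>) *\<^sub>R a) $ i"
  shows "v T $ i \<le> (((*v) A ^^ T) (v 0) + (\<Sum>\<sigma>\<in>{1..T}. w \<sigma> *\<^sub>R ((*v) A ^^ (T - \<sigma>)) a)) $ i"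
  using step
proof (induction T arbitrary: i)
  case (Suc T)
  define u where "u = ((*v) A ^^ T) (v 0) + (\<Sum>\<sigma>\<in>{1..T}. w \<sigma> *\<^sub>R ((*v) A ^^ (T - \<sigma>)) a)"
  have "v (Suc T) $ i \<le> (A *v v T + w (Suc T) *\<^sub>R a) $ i"
    using Suc.prems by simp
  also have "\<dots> \<le> (A *v u + w (Suc T) *\<^sub>R a) $ i"
    using matrix_vector_mono [OF A, of "v T" u] Suc unfolding u_def by simp
  also have "A *v u + w (Suc T) *\<^sub>R a
      = ((*v) A ^^ Suc T) (v 0) + (\<Sum>\<sigma>\<in>{1..Suc T}. w \<sigma> *\<^sub>R ((*v) A ^^ (Suc T - \<sigma>)) a)"
  proof -
    have "(\<Sum>\<sigma>\<in>{1..T}. A *v (w \<sigma> *\<^sub>R ((*v) A ^^ (T - \<sigma>)) a))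
        = (\<Sum>\<sigma>\<in>{1..T}. w \<sigma> *\<^sub>R ((*v) A ^^ (Suc T - \<sigma>)) a)"
      by (rule sum.cong) (auto simp: matrix_vector_mult_scaleR Suc_diff_le)
    then show ?thesis
      unfolding u_def by (simp add: matrix_vector_right_distrib matrix_vector_mult_sum sum.cl_ivl_Suc)
  qed
  finally show ?case .
qed simp

lemma mat2_mult_vector_1: "(mat2 a b c d *v v) $ 1 = a * v $ 1 + b * v $ 2"
  by (simp add: mat2_def matrix_vector_mult_def sum_2)

lemma mat2_mult_vector_2: "(mat2 a b c d *v v) $ 2 = c * v $ 1 + d * v $ 2"
  by (simp add: mat2_def matrix_vector_mult_def sum_2)

section \<open>Unitary similarity\<close>

definition cvec :: "real^'n::finite \<Rightarrow> complex^'n" where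
  "cvec y = (\<chi> i. complex_of_real (y $ i))"

lemma norm_cvec: "norm (cvec y) = norm y"
  unfolding norm_vec_def cvec_def by simp

lemma cmat_mult_cvec: "cmat A *v cvec y = cvec (A *v y)"
  by (simp add: cvec_def cmat_def matrix_vector_mult_def vec_eq_iff)

lemma funpow_cmat_cvec: "((*v) (cmat A) ^^ s) (cvec y) = cvec (((*v) (A::real^'n::finite^'n) ^^ s) y)"
  by (induction s) (simp_all add: cmat_mult_cvec)

lemma of_real_norm_sq_vec: "complex_of_real ((norm (z::complex^'n::finite))\<^sup>2) = (\<Sum>i\<in>UNIV. z $ i * cnj (z $ i))"
proof -
  have "(norm z)\<^sup>2 = (\<Sum>i\<in>UNIV. (norm (z $ i))\<^sup>2)"
    unfolding norm_vec_def L2_set_def by (simp add: sum_nonneg)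
  then show ?thesis
    by (simp only: of_real_sum complex_norm_square)
qed

lemma cadj_mult_self_entry:
  "cadj U ** U = mat 1 \<Longrightarrow> (\<Sum>i\<in>UNIV. cnj (U $ i $ k) * U $ i $ j) = (if k = j then 1 else 0)"
  by (drule arg_cong [of _ _ "\<lambda>M. M $ k $ j"]) (simp add: matrix_matrix_mult_def cadj_def mat_def)

lemma norm_unitary_mult:
  fixes U :: "complex^'n::finite^'n"
  assumes "cadj U ** U = mat 1"
  shows "norm (U *v w) = norm w"
proof -
  have "(\<Sum>i\<in>UNIV. (U *v w) $ i * cnj ((U *v w) $ i))
      = (\<Sum>i\<in>UNIV. \<Sum>k\<in>UNIV. \<Sum>j\<in>UNIV. w $ j * cnj (w $ k) * (cnj (U $ i $ k) * U $ i $ j))"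
    by (simp add: matrix_vector_mult_def sum_distrib_left sum_distrib_right cnj_sum algebra_simps)
  also have "\<dots> = (\<Sum>k\<in>UNIV. \<Sum>j\<in>UNIV. \<Sum>i\<in>UNIV. w $ j * cnj (w $ k) * (cnj (U $ i $ k) * U $ i $ j))"
    by (subst sum.swap) (rule sum.cong [OF refl], rule sum.swap)
  also have "\<dots> = (\<Sum>k\<in>UNIV. \<Sum>j\<in>UNIV. w $ j * cnj (w $ k) * (\<Sum>i\<in>UNIV. cnj (U $ i $ k) * U $ i $ j))"
    by (simp only: sum_distrib_left)
  also have "\<dots> = (\<Sum>j\<in>UNIV. w $ j * cnj (w $ j))"
    by (simp add: cadj_mult_self_entry [OF assms] if_distrib sum.delta' cong: if_cong)
  finally have "complex_of_real ((norm (U *v w))\<^sup>2) = complex_of_real ((norm w)\<^sup>2)"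
    by (simp only: of_real_norm_sq_vec)
  then have "(norm (U *v w))\<^sup>2 = (norm w)\<^sup>2"
    by (rule of_real_eq_iff [THEN iffD1])
  then show ?thesis
    by (simp add: power2_eq_iff_nonneg)
qed

lemma cadj_cadj [simp]: "cadj (cadj U) = U"
  by (simp add: cadj_def vec_eq_iff)

lemma funpow_unitary_conj:
  fixes U T :: "complex^'n::finite^'n"
  assumes "cadj U ** U = mat 1" and "U ** cadj U = mat 1"
  shows "((*v) (U ** T ** cadj U) ^^ s) z = U *v ((*v) T ^^ s) (cadj U *v z)"
proof (induction s)
  case 0
  then show ?case
    using assms(2) by (simp add: matrix_vector_mul_assoc)
next
  case (Suc s)
  have "((*v) (U ** T ** cadj U) ^^ Suc s) z = U *v (T *v ((cadj U ** U) *v ((*v) T ^^ s) (cadj U *v z)))"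
    using Suc by (simp add: matrix_vector_mul_assoc matrix_mul_assoc)
  then show ?case
    using assms(1) by simp
qed

lemma trace_unitary_conj:
  fixes U T :: "complex^'n::finite^'n"
  assumes "cadj U ** U = mat 1"
  shows "trace (U ** T ** cadj U) = trace T"
  by (metis assms matrix_mul_assoc matrix_mul_lid trace_mul_sym)

lemma eigenvalues_unitary_conj_subset:
  fixes U T :: "complex^'n::finite^'n"
  assumes "cadj U ** U = mat 1" and "U ** cadj U = mat 1"
  shows "eigenvalues (U ** T ** cadj U) \<subseteq> eigenvalues T"
proof
  fix z assume "z \<in> eigenvalues (U ** T ** cadj U)"
  then obtain v where v: "v \<noteq> 0" "(U ** T ** cadj U) *v v = z *s v"
    unfolding eigenvalues_def by blast
  have "T *v (cadj U *v v) = cadj U *v ((U ** T ** cadj U) *v v)"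
    using assms(1) by (simp add: matrix_vector_mul_assoc matrix_mul_assoc)
  also have "\<dots> = z *s (cadj U *v v)"
    by (simp add: v(2) vector_scalar_commute)
  finally have "T *v (cadj U *v v) = z *s (cadj U *v v)" .
  moreover have "cadj U *v v \<noteq> 0"
    using v(1) assms(2) by (metis matrix_vector_mul_assoc matrix_vector_mul_lid matrix_vector_mult_0_right)
  ultimately show "z \<in> eigenvalues T"
    unfolding eigenvalues_def by blast
qed

lemma eigenvalues_unitary_conj:
  fixes U T :: "complex^'n::finite^'n"
  assumes u1: "cadj U ** U = mat 1" and u2: "U ** cadj U = mat 1"
  shows "eigenvalues (U ** T ** cadj U) = eigenvalues T"
proof
  show "eigenvalues (U ** T ** cadj U) \<subseteq> eigenvalues T"
    using assms by (rule eigenvalues_unitary_conj_subset)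
  have "cadj U ** (U ** T ** cadj U) ** cadj (cadj U) = (cadj U ** U) ** T ** (cadj U ** U)"
    by (simp only: cadj_cadj matrix_mul_assoc)
  then have "cadj U ** (U ** T ** cadj U) ** cadj (cadj U) = T"
    using u1 by simp
  moreover have "eigenvalues (cadj U ** (U ** T ** cadj U) ** cadj (cadj U)) \<subseteq> eigenvalues (U ** T ** cadj U)"
    using u1 u2 by (intro eigenvalues_unitary_conj_subset) simp_all
  ultimately show "eigenvalues T \<subseteq> eigenvalues (U ** T ** cadj U)"
    by simp
qed

lemma eigenvalues_upper_triangular: "eigenvalues (mat2 a b 0 d) = {a, d :: complex}"
proof (intro equalityI subsetI)
  fix z assume "z \<in> eigenvalues (mat2 a b 0 d)"
  then obtain v where v: "v \<noteq> 0" "mat2 a b 0 d *v v = z *s v"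
    unfolding eigenvalues_def by blast
  have "a * v $ 1 + b * v $ 2 = z * v $ 1" "d * v $ 2 = z * v $ 2"
    using arg_cong [OF v(2), of "\<lambda>x. x $ 1"] arg_cong [OF v(2), of "\<lambda>x. x $ 2"]
    by (simp_all add: mat2_mult_vector_1 mat2_mult_vector_2)
  moreover have "v $ 1 \<noteq> 0 \<or> v $ 2 \<noteq> 0"
    using v(1) by (auto simp: vec_eq_iff forall_2)
  ultimately show "z \<in> {a, d}"
    by auto
next
  fix z assume "z \<in> {a, d}"
  define v :: "complex^2" where "v = (if z = a then (\<chi> i. if i = 1 then 1 else 0) else (\<chi> i. if i = 1 then b else d - a))"
  have "v \<noteq> 0" "mat2 a b 0 d *v v = z *s v"
    using \<open>z \<in> {a, d}\<close>
    by (auto simp: v_def vec_eq_iff forall_2 mat2_mult_vector_1 mat2_mult_vector_2 algebra_simps)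
  then show "z \<in> eigenvalues (mat2 a b 0 d)"
    unfolding eigenvalues_def by blast
qed

section \<open>Powers of a 2 by 2 Schur form\<close>

lemma geometric_sum_add: "(\<Sum>j<s + n. r ^ j) = (\<Sum>j<s. r ^ j) + r ^ s * (\<Sum>j<n. (r::real) ^ j)"
  by (induction n) (auto simp: power_add algebra_simps)

text \<open>Used with \<open>p = r ^ s\<close>, \<open>e = r ^ n\<close> and \<open>A\<close>, \<open>B\<close> the geometric sums of length \<open>s\<close>, \<open>n\<close>,
  for which \<open>A * (1 - e) = (1 - r) * A * B = B * (1 - p)\<close>.\<close>

lemma mixed_geometric_poly_ineq:
  fixes p e A B :: real
  assumes p: "0 \<le> p" "p \<le> 1" and e: "0 \<le> e" "e \<le> 1" and AB: "0 \<le> A" "0 \<le> B"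
    and ratio: "A * (1 - e) = B * (1 - p)"
  shows "A\<^sup>2 * (1 + p\<^sup>2 * e\<^sup>2) \<le> (A + p * B)\<^sup>2 * (1 - p\<^sup>2 + 2 * p\<^sup>2 * e\<^sup>2)"
proof -
  have "A\<^sup>2 * p\<^sup>2 * (1 - e\<^sup>2) = A * p\<^sup>2 * (1 + e) * (A * (1 - e))"
    by (simp add: power2_eq_square algebra_simps)
  also have "\<dots> = A * p\<^sup>2 * (1 + e) * (B * (1 - p))"
    by (simp only: ratio)
  also have "\<dots> = A * (p * (p * (1 + e))) * B * (1 - p)"
    by (simp add: power2_eq_square algebra_simps)
  also have "\<dots> \<le> A * (p * (2 * (1 + p))) * B * (1 - p)"
  proof -
    have "p * e \<le> 1"
      using p e by (intro mult_le_one) auto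
    then have "p * (p * (1 + e)) \<le> p * (2 * (1 + p))"
      using p by (intro mult_left_mono) (auto simp: algebra_simps)
    then show ?thesis
      using p AB by (intro mult_right_mono [OF mult_right_mono [OF mult_left_mono]]) auto
  qed
  also have "\<dots> = p * B * (2 * A) * (1 - p\<^sup>2)"
    by (simp add: power2_eq_square algebra_simps)
  also have "\<dots> \<le> p * B * (2 * A + p * B) * (1 - p\<^sup>2 + 2 * p\<^sup>2 * e\<^sup>2)"
    using p AB power_le_one [OF p, of 2] by (intro mult_mono mult_left_mono) auto
  finally have "A\<^sup>2 * p\<^sup>2 * (1 - e\<^sup>2) \<le> p * B * (2 * A + p * B) * (1 - p\<^sup>2 + 2 * p\<^sup>2 * e\<^sup>2)" .
  moreover have "(A + p * B)\<^sup>2 * (1 - p\<^sup>2 + 2 * p\<^sup>2 * e\<^sup>2) - A\<^sup>2 * (1 + p\<^sup>2 * e\<^sup>2)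
      = p * B * (2 * A + p * B) * (1 - p\<^sup>2 + 2 * p\<^sup>2 * e\<^sup>2) - A\<^sup>2 * p\<^sup>2 * (1 - e\<^sup>2)"
    by (simp add: power2_eq_square algebra_simps)
  ultimately show ?thesis
    by linarith
qed

lemma mixed_geometric_discriminant_ineq:
  fixes p e A B b :: real
  assumes p: "0 \<le> p" "p \<le> 1" and e: "0 \<le> e" "e \<le> 1" and AB: "0 \<le> A" "0 \<le> B" and b: "0 \<le> b"
    and ratio: "A * (1 - e) = B * (1 - p)"
  defines "c \<equiv> b * A" and "C \<equiv> b * (A + p * B)"
  defines "D \<equiv> p\<^sup>2 * e\<^sup>2 + C\<^sup>2"
  shows "c\<^sup>2 \<le> D * (1 + D - c\<^sup>2 - p\<^sup>2)"
proof -
  have cC: "c\<^sup>2 \<le> C\<^sup>2"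
    unfolding c_def C_def using AB b p by (intro power_mono mult_left_mono) auto
  have "c\<^sup>2 * (1 + p\<^sup>2 * e\<^sup>2) \<le> C\<^sup>2 * (1 - p\<^sup>2 + 2 * p\<^sup>2 * e\<^sup>2)"
    using mult_left_mono [OF mixed_geometric_poly_ineq [OF p e AB ratio], of "b\<^sup>2"]
    by (simp add: c_def C_def power_mult_distrib mult.assoc)
  moreover have "D * (1 + D - c\<^sup>2 - p\<^sup>2) = p\<^sup>2 * e\<^sup>2 * (1 - p\<^sup>2 + p\<^sup>2 * e\<^sup>2) + p\<^sup>2 * e\<^sup>2 * (C\<^sup>2 - c\<^sup>2)
      + C\<^sup>2 * (1 - p\<^sup>2 + p\<^sup>2 * e\<^sup>2) + C\<^sup>2 * (C\<^sup>2 - c\<^sup>2)"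
    unfolding D_def by (simp add: algebra_simps)
  moreover have "0 \<le> p\<^sup>2 * e\<^sup>2 * (1 - p\<^sup>2 + p\<^sup>2 * e\<^sup>2)"
    using power_le_one [OF p, of 2] by simp
  moreover have "0 \<le> C\<^sup>2 * (C\<^sup>2 - c\<^sup>2)"
    using cC by simp
  moreover have "0 \<le> p\<^sup>2 * e\<^sup>2 * (C\<^sup>2 - c\<^sup>2)"
    using cC by simp
  ultimately show ?thesis
    by (simp add: algebra_simps)
qed

lemma quadratic_form_le_scaled_norm:
  fixes D c q X Y :: real
  assumes "0 \<le> D" and disc: "c\<^sup>2 \<le> D * (1 + D - c\<^sup>2 - q)" and "q \<le> 1"
  shows "(X + c * Y)\<^sup>2 + q * Y\<^sup>2 \<le> (1 + D) * (X\<^sup>2 + Y\<^sup>2)"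
proof (cases "D = 0")
  case True
  then show ?thesis
    using assms mult_right_mono [of q 1 "Y\<^sup>2"] by simp
next
  case False
  have "D * ((1 + D) * (X\<^sup>2 + Y\<^sup>2) - (X + c * Y)\<^sup>2 - q * Y\<^sup>2)
      = (D * X - c * Y)\<^sup>2 + (D * (1 + D - c\<^sup>2 - q) - c\<^sup>2) * Y\<^sup>2"
    by (simp add: power2_eq_square algebra_simps)
  also have "\<dots> \<ge> 0"
    using disc by simp
  finally show ?thesis
    using False assms(1) by (simp add: zero_le_mult_iff)
qed

text \<open>Up to the factor \<open>l1 ^ s\<close>, the \<open>s\<close>-th power of \<open>[[l1, \<nu>], [0, l2]]\<close> is dominated by
  \<open>[[1, b * (\<Sum>j<s. r ^ j)], [0, r ^ s]]\<close> with \<open>r = \<bar>l2\<bar> / l1\<close>, \<open>b = \<bar>\<nu>\<bar> / l1\<close>. The quadratic form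
  below is the square of its norm, and \<open>\<mu>(t)\<^sup>2\<close> bounds it uniformly in \<open>s \<le> t\<close>.\<close>

lemma geometric_quadratic_form_le:
  fixes r b X Y :: real
  assumes r: "0 \<le> r" "r \<le> 1" and b: "0 \<le> b" and "s \<le> t"
  shows "(X + b * (\<Sum>j<s. r ^ j) * Y)\<^sup>2 + (r ^ s)\<^sup>2 * Y\<^sup>2
    \<le> (1 + r ^ (2 * t) + b\<^sup>2 * (\<Sum>j<t. r ^ j)\<^sup>2) * (X\<^sup>2 + Y\<^sup>2)"
proof -
  obtain n where t: "t = s + n"
    using \<open>s \<le> t\<close> le_Suc_ex by blast
  define p where "p = r ^ s"
  define e where "e = r ^ n"
  define A where "A = (\<Sum>j<s. r ^ j)"
  define B where "B = (\<Sum>j<n. r ^ j)"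
  define D where "D = p\<^sup>2 * e\<^sup>2 + (b * (A + p * B))\<^sup>2"
  have p: "0 \<le> p" "p \<le> 1" and e: "0 \<le> e" "e \<le> 1"
    unfolding p_def e_def using r by (simp_all add: power_le_one)
  have AB: "0 \<le> A" "0 \<le> B"
    unfolding A_def B_def using r by (simp_all add: sum_nonneg)
  have "A * (1 - e) = (1 - r) * A * B"
    unfolding A_def B_def e_def by (simp add: one_diff_power_eq [of r n])
  also have "\<dots> = B * (1 - p)"
    unfolding A_def B_def p_def by (simp add: one_diff_power_eq [of r s])
  finally have disc: "(b * A)\<^sup>2 \<le> D * (1 + D - (b * A)\<^sup>2 - p\<^sup>2)"
    unfolding D_def by (rule mixed_geometric_discriminant_ineq [OF p e AB b])
  have "(X + b * A * Y)\<^sup>2 + p\<^sup>2 * Y\<^sup>2 \<le> (1 + D) * (X\<^sup>2 + Y\<^sup>2)"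
    using quadratic_form_le_scaled_norm [OF _ disc] power_le_one [OF p, of 2]
    by (simp add: D_def)
  moreover have "r ^ (2 * t) = p\<^sup>2 * e\<^sup>2"
    unfolding t p_def e_def by (simp add: power_add power_mult power2_eq_square algebra_simps)
  moreover have "(\<Sum>j<t. r ^ j) = A + p * B"
    unfolding t p_def A_def B_def by (rule geometric_sum_add)
  ultimately show ?thesis
    unfolding D_def A_def p_def by (simp add: power_mult_distrib add.assoc)
qed

lemma norm_vec2: "norm (v::'a::real_normed_vector^2) = sqrt ((norm (v $ 1))\<^sup>2 + (norm (v $ 2))\<^sup>2)"
  unfolding norm_vec_def L2_set_def by (simp add: sum_2)

text \<open>The upper right entry of the \<open>s\<close>-th power of \<open>[[l1, 1], [0, l2]]\<close>, that is,
  the sum of \<open>l1 ^ (s - 1 - j) * l2 ^ j\<close> over \<open>j < s\<close>.\<close>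

fun triangular_offdiag :: "real \<Rightarrow> real \<Rightarrow> nat \<Rightarrow> real" where
  "triangular_offdiag l1 l2 0 = 0"
| "triangular_offdiag l1 l2 (Suc s) = l1 * triangular_offdiag l1 l2 s + l2 ^ s"

lemma triangular_power_components:
  "((*v) (mat2 (complex_of_real l1) nu 0 (complex_of_real l2)) ^^ s) w $ 1
     = complex_of_real (l1 ^ s) * w $ 1 + nu * complex_of_real (triangular_offdiag l1 l2 s) * w $ 2
   \<and> ((*v) (mat2 (complex_of_real l1) nu 0 (complex_of_real l2)) ^^ s) w $ 2
     = complex_of_real (l2 ^ s) * w $ 2"
  by (induction s) (simp_all add: mat2_mult_vector_1 mat2_mult_vector_2 algebra_simps)

lemma abs_triangular_offdiag_le:
  assumes l1: "0 < l1" and "\<bar>l2\<bar> \<le> l1"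
  shows "l1 * \<bar>triangular_offdiag l1 l2 s\<bar> \<le> l1 ^ s * (\<Sum>j<s. (\<bar>l2\<bar> / l1) ^ j)"
proof (induction s)
  case (Suc s)
  have "l1 * \<bar>triangular_offdiag l1 l2 (Suc s)\<bar> \<le> l1 * (l1 * \<bar>triangular_offdiag l1 l2 s\<bar> + \<bar>l2\<bar> ^ s)"
    using l1 by (intro mult_left_mono) (auto simp: abs_mult power_abs intro: order_trans [OF abs_triangle_ineq])
  also have "\<dots> \<le> l1 * (l1 ^ s * (\<Sum>j<s. (\<bar>l2\<bar> / l1) ^ j) + \<bar>l2\<bar> ^ s)"
    using Suc l1 by (intro mult_left_mono add_mono) auto
  also have "\<dots> = l1 ^ Suc s * (\<Sum>j<Suc s. (\<bar>l2\<bar> / l1) ^ j)"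
    using l1 by (simp add: power_divide algebra_simps)
  finally show ?case .
qed simp

lemma mu_squared:
  assumes "0 < l1"
  shows "(mu l1 l2 nu t)\<^sup>2 = 1 + (\<bar>l2\<bar> / l1) ^ (2 * t) + (cmod nu / l1)\<^sup>2 * (\<Sum>j<t. (\<bar>l2\<bar> / l1) ^ j)\<^sup>2"
  using assms unfolding mu_def Let_def
  by (subst real_sqrt_pow2) (simp_all add: power_divide add_nonneg_nonneg)

lemma
  assumes l1: "0 < l1" and l2: "\<bar>l2\<bar> \<le> l1"
  shows cmod_triangular_power_fst_le:
      "cmod ((((*v) (mat2 (complex_of_real l1) nu 0 (complex_of_real l2)) ^^ s) w) $ 1)
         \<le> l1 ^ s * (cmod (w $ 1) + cmod nu / l1 * (\<Sum>j<s. (\<bar>l2\<bar> / l1) ^ j) * cmod (w $ 2))"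
    and cmod_triangular_power_snd:
      "cmod ((((*v) (mat2 (complex_of_real l1) nu 0 (complex_of_real l2)) ^^ s) w) $ 2)
         = l1 ^ s * ((\<bar>l2\<bar> / l1) ^ s * cmod (w $ 2))"
proof -
  note components = triangular_power_components [of s l1 nu l2 w]
  have "cmod ((((*v) (mat2 (complex_of_real l1) nu 0 (complex_of_real l2)) ^^ s) w) $ 1)
      \<le> l1 ^ s * cmod (w $ 1) + cmod nu / l1 * (l1 * \<bar>triangular_offdiag l1 l2 s\<bar>) * cmod (w $ 2)"
    using components l1 by (auto simp: norm_mult norm_power intro!: order_trans [OF norm_triangle_ineq])
  also have "\<dots> \<le> l1 ^ s * cmod (w $ 1) + cmod nu / l1 * (l1 ^ s * (\<Sum>j<s. (\<bar>l2\<bar> / l1) ^ j)) * cmod (w $ 2)"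
    using abs_triangular_offdiag_le [OF l1 l2] l1
    by (intro add_left_mono mult_right_mono mult_left_mono) auto
  finally show "cmod ((((*v) (mat2 (complex_of_real l1) nu 0 (complex_of_real l2)) ^^ s) w) $ 1)
      \<le> l1 ^ s * (cmod (w $ 1) + cmod nu / l1 * (\<Sum>j<s. (\<bar>l2\<bar> / l1) ^ j) * cmod (w $ 2))"
    by (simp add: algebra_simps)
  show "cmod ((((*v) (mat2 (complex_of_real l1) nu 0 (complex_of_real l2)) ^^ s) w) $ 2)
      = l1 ^ s * ((\<bar>l2\<bar> / l1) ^ s * cmod (w $ 2))"
    using components l1 by (simp add: norm_mult power_divide power_abs norm_power)
qed

lemma norm_triangular_power_le:
  assumes l1: "0 < l1" and l2: "\<bar>l2\<bar> \<le> l1" and "s \<le> t"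
  shows "norm (((*v) (mat2 (complex_of_real l1) nu 0 (complex_of_real l2)) ^^ s) w)
    \<le> mu l1 l2 nu t * l1 ^ s * norm w"
proof -
  define r where "r = \<bar>l2\<bar> / l1"
  define b where "b = cmod nu / l1"
  define X where "X = cmod (w $ 1)"
  define Y where "Y = cmod (w $ 2)"
  define v where "v = ((*v) (mat2 (complex_of_real l1) nu 0 (complex_of_real l2)) ^^ s) w"
  have r: "0 \<le> r" "r \<le> 1" and b: "0 \<le> b"
    unfolding r_def b_def using l1 l2 by auto
  have "(norm v)\<^sup>2 \<le> (l1 ^ s * (X + b * (\<Sum>j<s. r ^ j) * Y))\<^sup>2 + (l1 ^ s * (r ^ s * Y))\<^sup>2"
    unfolding norm_vec2 v_def r_def b_def X_def Y_def
    using cmod_triangular_power_fst_le [OF l1 l2] cmod_triangular_power_snd [OF l1 l2]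
    by (auto intro!: power_mono)
  also have "\<dots> = (l1 ^ s)\<^sup>2 * ((X + b * (\<Sum>j<s. r ^ j) * Y)\<^sup>2 + (r ^ s)\<^sup>2 * Y\<^sup>2)"
    by (simp only: power_mult_distrib flip: distrib_left)
  also have "\<dots> \<le> (l1 ^ s)\<^sup>2 * ((1 + r ^ (2 * t) + b\<^sup>2 * (\<Sum>j<t. r ^ j)\<^sup>2) * (X\<^sup>2 + Y\<^sup>2))"
    using geometric_quadratic_form_le [OF r b \<open>s \<le> t\<close>] by (intro mult_left_mono) auto
  also have "\<dots> = (mu l1 l2 nu t * l1 ^ s * norm w)\<^sup>2"
    using mu_squared [OF l1, of l2 nu t, folded r_def b_def]
    by (simp add: norm_vec2 [of w] X_def Y_def power_mult_distrib)
  finally have "(norm v)\<^sup>2 \<le> (mu l1 l2 nu t * l1 ^ s * norm w)\<^sup>2" .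
  moreover have "0 \<le> mu l1 l2 nu t * l1 ^ s * norm w"
    using l1 by (simp add: mu_def Let_def)
  ultimately show ?thesis
    unfolding v_def by (rule power2_le_imp_le)
qed

context
  fixes A :: "real^2^2" and U :: "complex^2^2" and l1 l2 :: real and nu :: complex
  assumes unitary: "unitary U" and l2_le_l1: "l2 \<le> l1"
    and schur: "cmat A = U ** mat2 (complex_of_real l1) nu 0 (complex_of_real l2) ** cadj U"
    and trace_pos: "0 < A $ 1 $ 1 + A $ 2 $ 2"
begin

lemma schur_l1_pos: "0 < l1" and schur_abs_l2_le: "\<bar>l2\<bar> \<le> l1"
proof -
  have "cadj U ** U = mat 1"
    using unitary unfolding unitary_def by simp
  then have "trace (cmat A) = complex_of_real (l1 + l2)"
    unfolding schur by (simp only: trace_unitary_conj) (simp add: trace_def sum_2 mat2_def)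
  then have "A $ 1 $ 1 + A $ 2 $ 2 = l1 + l2"
    by (simp add: trace_def sum_2 cmat_def flip: of_real_add)
  then show "0 < l1" "\<bar>l2\<bar> \<le> l1"
    using trace_pos l2_le_l1 by linarith+
qed

lemma eigenvalues_schur: "eigenvalues (cmat A) = {complex_of_real l1, complex_of_real l2}"
  using unitary unfolding unitary_def schur
  by (simp add: eigenvalues_unitary_conj eigenvalues_upper_triangular)

lemma spec_rad_schur: "spec_rad A = l1"
  unfolding spec_rad_def eigenvalues_schur using schur_l1_pos schur_abs_l2_le by simp

lemma norm_funpow_schur_le:
  assumes "s \<le> t"
  shows "norm (((*v) A ^^ s) y) \<le> mu l1 l2 nu t * l1 ^ s * norm y"
proof -
  have u1: "cadj U ** U = mat 1" and u2: "U ** cadj U = mat 1"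
    using unitary unfolding unitary_def by auto
  have "norm (((*v) A ^^ s) y) = norm (((*v) (cmat A) ^^ s) (cvec y))"
    by (simp only: funpow_cmat_cvec norm_cvec)
  also have "\<dots> = norm (((*v) (mat2 (complex_of_real l1) nu 0 (complex_of_real l2)) ^^ s) (cadj U *v cvec y))"
    by (simp only: schur funpow_unitary_conj [OF u1 u2] norm_unitary_mult [OF u1])
  also have "\<dots> \<le> mu l1 l2 nu t * l1 ^ s * norm (cadj U *v cvec y)"
    using schur_l1_pos schur_abs_l2_le assms by (rule norm_triangular_power_le)
  also have "norm (cadj U *v cvec y) = norm y"
    using norm_unitary_mult [of "cadj U" "cvec y"] u2 by (simp only: cadj_cadj norm_cvec)
  finally show ?thesis .
qed

end

section \<open>Error recursion of a single layer\<close>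

definition state_dist :: "'c::finite lstate \<Rightarrow> 'c lstate \<Rightarrow> real^2" where
  "state_dist a b = (\<chi> i. if i = 1 then norm (fst a - fst b) else norm (snd a - snd b))"

lemma norm_state_dist: "norm (state_dist a b) = norm (a - b)"
proof -
  have "a - b = (fst a - fst b, snd a - snd b)"
    by (simp add: prod_eq_iff)
  then show ?thesis
    by (simp add: norm_vec_def L2_set_def sum_2 state_dist_def norm_Pair)
qed

lemma state_dist_nonneg: "0 \<le> state_dist a b $ i"
  unfolding state_dist_def by simp

lemma alpha_s_nonneg: "0 \<le> alpha_s P xmax l k"
  unfolding alpha_s_def
  by (intro add_nonneg_nonneg mult_nonneg_nonneg Unorm_nonneg cbar_nonneg sigbar_nonneg phibar_nonneg) auto

lemma A_s_nonneg: "0 \<le> A_s P xmax l k $ i $ j"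
  unfolding A_s_def mat2_def
  using alpha_s_nonneg [of P xmax l k] tanh_cbar_nonneg [of P xmax l k] sigbar_nonneg [of P xmax l]
    Unorm_nonneg [of P l Go]
  by (auto intro!: add_nonneg_nonneg)

lemma A_s_trace_pos: "0 < A_s P xmax l k $ 1 $ 1 + A_s P xmax l k $ 2 $ 2"
  unfolding A_s_def mat2_def
  using alpha_s_nonneg [of P xmax l k] tanh_cbar_nonneg [of P xmax l k] sigbar_nonneg [of P xmax l Go k]
    sigbar_pos [of P xmax l Gf k] Unorm_nonneg [of P l Go]
  by (simp add: add_pos_nonneg)

lemma cell_state_dist_le:
  assumes "0 \<le> xmax" "s1 \<in> Sset P xmax l k" "s2 \<in> Sset P xmax l k"
    and "\<And>g j. \<bar>wx1 g $ j\<bar> \<le> Wrow P xmax l g $ j" "\<And>g j. \<bar>wx2 g $ j\<bar> \<le> Wrow P xmax l g $ j"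
    and "\<And>g. norm (wx1 g - wx2 g) \<le> Wnorm P l g * d"
  shows "state_dist (cell P l wx1 s1) (cell P l wx2 s2) $ i
    \<le> (A_s P xmax l k *v state_dist s1 s2 + d *\<^sub>R a_x P xmax l k) $ i"
  using norm_cell_fst_diff_le [OF assms] norm_cell_snd_diff_le [OF assms] exhaust_2 [of i]
  by (auto simp: state_dist_def A_s_def a_x_def mat2_mult_vector_1 mat2_mult_vector_2 algebra_simps)

lemma norm_snd_diff_le: "norm (snd a - snd b) \<le> norm (a - b)"
  by (metis fst_diff norm_snd_le prod.collapse snd_diff)

definition layer_input :: "('x::finite, 'c::finite) lstm \<Rightarrow> real^'x \<Rightarrow> (nat \<Rightarrow> 'c lstate) \<Rightarrow> nat \<Rightarrow> gate \<Rightarrow> real^'c"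
  where "layer_input P xv s l g =
    (if l = 1 then Win P g *v xv else Wh P l g *v snd (newst P xv s (l - 1)))"

lemma newst_eq_cell: "1 \<le> l \<Longrightarrow> newst P xv s l = cell P l (layer_input P xv s l) (s l)"
proof (cases l)
  case (Suc m)
  then show ?thesis
    by (cases m) (simp_all add: layer_input_def [abs_def])
qed simp

lemma abs_newst_snd_le_1: "1 \<le> l \<Longrightarrow> \<bar>snd (newst P xv s l) $ j\<bar> \<le> 1"
  by (simp add: newst_eq_cell abs_cell_snd_le_1)

lemma abs_layer_input_le_Wrow:
  assumes "1 \<le> l" and "\<And>j. \<bar>xv $ j\<bar> \<le> xmax"
  shows "\<bar>layer_input P xv s l g $ j\<bar> \<le> Wrow P xmax l g $ j"
  using assms abs_matrix_vector_le_absrow [of xv xmax "Win P g" j]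
    abs_matrix_vector_le_absrow [of "snd (newst P xv s (l - 1))" 1 "Wh P l g" j]
    abs_newst_snd_le_1 [of "l - 1" P xv s]
  by (auto simp: layer_input_def Wrow_def)

lemma norm_layer_input_diff_le:
  "norm (layer_input P xv s l g - layer_input P xv s' l g)
     \<le> Wnorm P l g * (if l = 1 then 0 else norm (newst P xv s (l - 1) - newst P xv s' (l - 1)))"
proof (cases "l = 1")
  case False
  have "norm (Wh P l g *v (snd (newst P xv s (l - 1)) - snd (newst P xv s' (l - 1))))
      \<le> Wnorm P l g * norm (snd (newst P xv s (l - 1)) - snd (newst P xv s' (l - 1)))"
    using False by (simp add: Wnorm_def norm_matrix_vector_le_onorm)
  also have "\<dots> \<le> Wnorm P l g * norm (newst P xv s (l - 1) - newst P xv s' (l - 1))"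
    by (intro mult_left_mono norm_snd_diff_le Wnorm_nonneg)
  finally show ?thesis
    using False by (simp add: layer_input_def matrix_vector_mult_diff_distrib)
qed (simp add: layer_input_def)

lemma newst_in_Sset:
  assumes "0 \<le> xmax" "1 \<le> l" "s l \<in> Sset P xmax l k" "\<And>j. \<bar>xv $ j\<bar> \<le> xmax"
  shows "newst P xv s l \<in> Sset P xmax l k"
  unfolding newst_eq_cell [OF assms(2)]
  using assms by (intro cell_in_Sset abs_layer_input_le_Wrow)

lemma newst_state_dist_le:
  assumes "0 \<le> xmax" "1 \<le> l" "s l \<in> Sset P xmax l k" "s' l \<in> Sset P xmax l k"
    and "\<And>j. \<bar>xv $ j\<bar> \<le> xmax"
  shows "state_dist (newst P xv s l) (newst P xv s' l) $ i
    \<le> (A_s P xmax l k *v state_dist (s l) (s' l)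
       + (if l = 1 then 0 else norm (newst P xv s (l - 1) - newst P xv s' (l - 1))) *\<^sub>R a_x P xmax l k) $ i"
  unfolding newst_eq_cell [OF assms(2)]
  using assms by (intro cell_state_dist_le abs_layer_input_le_Wrow norm_layer_input_diff_le)

lemma traj_in_Sset:
  assumes "0 \<le> xmax" "\<forall>l\<in>{1..L}. s l \<in> Sset P xmax l k" "\<forall>\<tau>\<le>t. \<forall>j. \<bar>x \<tau> $ j\<bar> \<le> xmax"
    and "\<tau> \<le> t" "l \<in> {1..L}"
  shows "traj P s x \<tau> l \<in> Sset P xmax l k"
  using assms(4,5)
proof (induction \<tau> arbitrary: l)
  case (Suc \<tau>)
  then show ?case
    using assms(1,3) by (auto intro: newst_in_Sset)
qed (use assms(2) in simp)

lemma norm_traj_diff_le_convolution: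
  fixes P :: "('x::finite, 'c::finite) lstm" and x :: "nat \<Rightarrow> real^'x"
  assumes xmax: "0 \<le> xmax" and S1: "\<forall>l\<in>{1..L}. s1 l \<in> Sset P xmax l k" and S2: "\<forall>l\<in>{1..L}. s2 l \<in> Sset P xmax l k"
    and inp: "\<forall>\<tau>\<le>t. \<forall>j. \<bar>x \<tau> $ j\<bar> \<le> xmax"
    and l: "l \<in> {1..L}" and "T \<le> t"
    and power: "\<And>s y. s \<le> t \<Longrightarrow> norm (((*v) (A_s P xmax l k) ^^ s) y) \<le> M * R ^ s * norm y"
    and "0 \<le> M" "0 \<le> R"
  shows "norm (traj P s1 x T l - traj P s2 x T l) \<le> M * R ^ T * norm (s1 l - s2 l)
     + (\<Sum>\<sigma>\<in>{1..T}. M * R ^ (T - \<sigma>) * norm (a_x P xmax l k) *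
          (if l = 1 then 0 else norm (traj P s1 x \<sigma> (l - 1) - traj P s2 x \<sigma> (l - 1))))"
proof -
  define A where "A = A_s P xmax l k"
  define a where "a = a_x P xmax l k"
  define v where "v \<tau> = state_dist (traj P s1 x \<tau> l) (traj P s2 x \<tau> l)" for \<tau>
  define w where "w \<sigma> = (if l = 1 then 0 else norm (traj P s1 x \<sigma> (l - 1) - traj P s2 x \<sigma> (l - 1)))" for \<sigma>
  have w_nonneg: "0 \<le> w \<sigma>" for \<sigma>
    unfolding w_def by simp
  have "v (Suc \<tau>) $ i \<le> (A *v v \<tau> + w (Suc \<tau>) *\<^sub>R a) $ i" if "\<tau> < T" for \<tau> i
    unfolding v_def w_def A_def a_def traj.simps
    using that \<open>T \<le> t\<close> l inp traj_in_Sset [OF xmax S1 inp] traj_in_Sset [OF xmax S2 inp]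
    by (intro newst_state_dist_le [OF xmax]) auto
  then have "v T $ i \<le> (((*v) A ^^ T) (v 0) + (\<Sum>\<sigma>\<in>{1..T}. w \<sigma> *\<^sub>R ((*v) A ^^ (T - \<sigma>)) a)) $ i" for i
    by (intro componentwise_recursion_le) (auto simp: A_def A_s_nonneg)
  then have "norm (v T) \<le> norm (((*v) A ^^ T) (v 0) + (\<Sum>\<sigma>\<in>{1..T}. w \<sigma> *\<^sub>R ((*v) A ^^ (T - \<sigma>)) a))"
    by (intro norm_le_of_abs_le) (simp add: v_def state_dist_nonneg)
  also have "\<dots> \<le> norm (((*v) A ^^ T) (v 0)) + (\<Sum>\<sigma>\<in>{1..T}. w \<sigma> * norm (((*v) A ^^ (T - \<sigma>)) a))"
    by (intro order_trans [OF norm_triangle_ineq] add_left_mono order_trans [OF norm_sum])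
      (simp add: w_nonneg)
  also have "\<dots> \<le> M * R ^ T * norm (v 0) + (\<Sum>\<sigma>\<in>{1..T}. w \<sigma> * (M * R ^ (T - \<sigma>) * norm a))"
    using \<open>T \<le> t\<close> w_nonneg by (intro add_mono sum_mono mult_left_mono) (auto simp: A_def power)
  finally show ?thesis
    by (simp add: v_def w_def a_def norm_state_dist mult.commute)
qed

section \<open>Combining the layers\<close>

lemma sum_shifted_choose: "(\<Sum>\<sigma>\<in>{1..\<tau>}. (\<sigma> - 1 + k) choose k) = (\<tau> + k) choose Suc k"
  by (induction \<tau>) (simp_all add: sum.cl_ivl_Suc)

text \<open>Gain from the initial error of layer \<open>m\<close> to the error of layer \<open>l \<ge> m\<close> after \<open>\<tau>\<close> steps.\<close>

definition layer_gain :: "(nat \<Rightarrow> real) \<Rightarrow> (nat \<Rightarrow> real) \<Rightarrow> (nat \<Rightarrow> real) \<Rightarrow> nat \<Rightarrow> nat \<Rightarrow> nat \<Rightarrow> real" where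
  "layer_gain M R \<alpha> l m \<tau> =
     (\<Prod>i = m..l. M i) * real ((\<tau> + l - m - 1) choose (l - m)) * (Max (R ` {m..l})) ^ \<tau>
     * (\<Prod>i = Suc m..l. \<alpha> i)"

lemma mult_power_Max_le:
  fixes R :: "nat \<Rightarrow> real"
  assumes R: "\<And>i. i \<in> {m..Suc l} \<Longrightarrow> 0 \<le> R i" and "m \<le> l" and "\<sigma> \<le> \<tau>"
  shows "R (Suc l) ^ (\<tau> - \<sigma>) * Max (R ` {m..l}) ^ \<sigma> \<le> Max (R ` {m..Suc l}) ^ \<tau>"
proof -
  have max_le: "R (Suc l) \<le> Max (R ` {m..Suc l})" "Max (R ` {m..l}) \<le> Max (R ` {m..Suc l})"
    using \<open>m \<le> l\<close> by (auto intro!: Max_ge Max_mono)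
  have "R m \<le> Max (R ` {m..l})"
    using \<open>m \<le> l\<close> by (intro Max_ge) auto
  moreover have "0 \<le> R m"
    using R \<open>m \<le> l\<close> by simp
  ultimately have max_nonneg: "0 \<le> Max (R ` {m..l})" "0 \<le> Max (R ` {m..Suc l})"
    using max_le(2) by linarith+
  have "R (Suc l) ^ (\<tau> - \<sigma>) * Max (R ` {m..l}) ^ \<sigma>
      \<le> Max (R ` {m..Suc l}) ^ (\<tau> - \<sigma>) * Max (R ` {m..Suc l}) ^ \<sigma>"
    by (intro mult_mono power_mono) (use max_le max_nonneg R [of "Suc l"] \<open>m \<le> l\<close> in auto)
  then show ?thesis
    using \<open>\<sigma> \<le> \<tau>\<close> by (simp flip: power_add)
qed

lemma layer_gain_step:
  fixes M R \<alpha> :: "nat \<Rightarrow> real"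
  assumes M: "\<And>i. i \<in> {m..Suc l} \<Longrightarrow> 0 \<le> M i" and R: "\<And>i. i \<in> {m..Suc l} \<Longrightarrow> 0 \<le> R i"
    and \<alpha>: "\<And>i. i \<in> {m..Suc l} \<Longrightarrow> 0 \<le> \<alpha> i" and "m \<le> l"
  shows "(\<Sum>\<sigma>\<in>{1..\<tau>}. M (Suc l) * R (Suc l) ^ (\<tau> - \<sigma>) * \<alpha> (Suc l) * layer_gain M R \<alpha> l m \<sigma>)
    \<le> layer_gain M R \<alpha> (Suc l) m \<tau>"
proof -
  define k where "k = l - m"
  define PM where "PM = (\<Prod>i = m..Suc l. M i)"
  define PA where "PA = (\<Prod>i = Suc m..Suc l. \<alpha> i)"
  define Rmax where "Rmax = Max (R ` {m..Suc l})"
  have PM_PA: "0 \<le> PM * PA"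
    unfolding PM_def PA_def using M \<alpha> by (auto intro!: mult_nonneg_nonneg prod_nonneg)
  have "M (Suc l) * R (Suc l) ^ (\<tau> - \<sigma>) * \<alpha> (Suc l) * layer_gain M R \<alpha> l m \<sigma>
      \<le> PM * PA * Rmax ^ \<tau> * real ((\<sigma> - 1 + k) choose k)" if "\<sigma> \<in> {1..\<tau>}" for \<sigma>
  proof -
    have "PM * PA * real ((\<sigma> - 1 + k) choose k) * (R (Suc l) ^ (\<tau> - \<sigma>) * Max (R ` {m..l}) ^ \<sigma>)
        \<le> PM * PA * real ((\<sigma> - 1 + k) choose k) * Rmax ^ \<tau>"
      unfolding Rmax_def using that PM_PA R \<open>m \<le> l\<close> by (intro mult_left_mono mult_power_Max_le) auto
    moreover have "\<sigma> + l - m - 1 = \<sigma> - 1 + k"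
      unfolding k_def using that \<open>m \<le> l\<close> by auto
    ultimately show ?thesis
      using \<open>m \<le> l\<close> unfolding layer_gain_def PM_def PA_def k_def
      by (simp add: prod.nat_ivl_Suc' algebra_simps)
  qed
  then have "(\<Sum>\<sigma>\<in>{1..\<tau>}. M (Suc l) * R (Suc l) ^ (\<tau> - \<sigma>) * \<alpha> (Suc l) * layer_gain M R \<alpha> l m \<sigma>)
      \<le> (\<Sum>\<sigma>\<in>{1..\<tau>}. PM * PA * Rmax ^ \<tau> * real ((\<sigma> - 1 + k) choose k))"
    by (rule sum_mono)
  also have "\<dots> = PM * PA * Rmax ^ \<tau> * real (\<Sum>\<sigma>\<in>{1..\<tau>}. (\<sigma> - 1 + k) choose k)"
    by (simp add: sum_distrib_left)
  also have "\<dots> = layer_gain M R \<alpha> (Suc l) m \<tau>"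
    using \<open>m \<le> l\<close> unfolding layer_gain_def sum_shifted_choose PM_def PA_def Rmax_def k_def
    by (simp add: Suc_diff_le algebra_simps)
  finally show ?thesis .
qed

lemma layered_recursion_bound:
  fixes n :: "nat \<Rightarrow> nat \<Rightarrow> real" and M R \<alpha> :: "nat \<Rightarrow> real"
  assumes M: "\<And>i. i \<in> {1..L} \<Longrightarrow> 0 \<le> M i" and R: "\<And>i. i \<in> {1..L} \<Longrightarrow> 0 \<le> R i"
    and \<alpha>: "\<And>i. i \<in> {1..L} \<Longrightarrow> 0 \<le> \<alpha> i" and n: "\<And>l. 0 \<le> n l 0"
    and layer: "\<And>l \<tau>. l \<in> {1..L} \<Longrightarrow> \<tau> \<le> t \<Longrightarrow> n l \<tau> \<le> M l * R l ^ \<tau> * n l 0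
        + (\<Sum>\<sigma>\<in>{1..\<tau>}. M l * R l ^ (\<tau> - \<sigma>) * \<alpha> l * (if l = 1 then 0 else n (l - 1) \<sigma>))"
  shows "1 \<le> l \<Longrightarrow> l \<le> L \<Longrightarrow> \<tau> \<le> t \<Longrightarrow> n l \<tau> \<le> (\<Sum>m\<in>{1..l}. layer_gain M R \<alpha> l m \<tau> * n m 0)"
proof (induction l arbitrary: \<tau> rule: nat_induct_at_least)
  case base
  then show ?case
    using layer [of 1 \<tau>] by (simp add: layer_gain_def)
next
  case (Suc l)
  define c where "c \<sigma> = M (Suc l) * R (Suc l) ^ (\<tau> - \<sigma>) * \<alpha> (Suc l)" for \<sigma>
  have c_nonneg: "0 \<le> c \<sigma>" for \<sigma>
    unfolding c_def using Suc M R \<alpha> by simp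
  have "n (Suc l) \<tau> \<le> M (Suc l) * R (Suc l) ^ \<tau> * n (Suc l) 0 + (\<Sum>\<sigma>\<in>{1..\<tau>}. c \<sigma> * n l \<sigma>)"
    using layer [of "Suc l" \<tau>] Suc by (simp add: c_def)
  also have "\<dots> \<le> M (Suc l) * R (Suc l) ^ \<tau> * n (Suc l) 0
      + (\<Sum>\<sigma>\<in>{1..\<tau>}. c \<sigma> * (\<Sum>m\<in>{1..l}. layer_gain M R \<alpha> l m \<sigma> * n m 0))"
    using Suc c_nonneg by (intro add_left_mono sum_mono mult_left_mono) auto
  also have "(\<Sum>\<sigma>\<in>{1..\<tau>}. c \<sigma> * (\<Sum>m\<in>{1..l}. layer_gain M R \<alpha> l m \<sigma> * n m 0))
      = (\<Sum>m\<in>{1..l}. (\<Sum>\<sigma>\<in>{1..\<tau>}. c \<sigma> * layer_gain M R \<alpha> l m \<sigma>) * n m 0)"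
    unfolding sum_distrib_left sum_distrib_right by (subst sum.swap) (simp add: mult.assoc)
  also have "\<dots> \<le> (\<Sum>m\<in>{1..l}. layer_gain M R \<alpha> (Suc l) m \<tau> * n m 0)"
    unfolding c_def using Suc M R \<alpha> n
    by (intro sum_mono mult_right_mono layer_gain_step) auto
  finally show ?case
    using Suc by (simp add: sum.cl_ivl_Suc layer_gain_def algebra_simps)
qed

lemma layer_gain_le_binomial:
  fixes M R \<alpha> :: "nat \<Rightarrow> real"
  assumes M: "\<And>i. i \<in> {m..l} \<Longrightarrow> 0 \<le> M i" and R: "\<And>i. i \<in> {m..l} \<Longrightarrow> 0 \<le> R i"
    and \<alpha>: "\<And>i. i \<in> {m..l} \<Longrightarrow> 0 \<le> \<alpha> i" and "m \<le> l"
  shows "layer_gain M R \<alpha> l m t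
    \<le> (\<Prod>i = m..l. M i) * (fact (t + l - m) / (fact t * fact (l - m)))
      * Max ((\<lambda>i. R i ^ t) ` {m..l}) * (\<Prod>i = Suc m..l. \<alpha> i)"
proof -
  have "real ((t + l - m - 1) choose (l - m)) \<le> real ((t + l - m) choose (l - m))"
    by (simp add: binomial_right_mono)
  also have "\<dots> = fact (t + l - m) / (fact t * fact (l - m))"
    using \<open>m \<le> l\<close> by (simp add: binomial_fact mult.commute)
  finally have binomial: "real ((t + l - m - 1) choose (l - m)) \<le> fact (t + l - m) / (fact t * fact (l - m))" .
  have "Max (R ` {m..l}) \<in> R ` {m..l}"
    using \<open>m \<le> l\<close> by (intro Max_in) auto
  then obtain j where j: "j \<in> {m..l}" "Max (R ` {m..l}) = R j"
    by auto
  then have max_power: "(Max (R ` {m..l})) ^ t \<le> Max ((\<lambda>i. R i ^ t) ` {m..l})"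
    by (simp add: Max_ge)
  have "0 \<le> (\<Prod>i = m..l. M i)" "0 \<le> (\<Prod>i = Suc m..l. \<alpha> i)" "0 \<le> (Max (R ` {m..l})) ^ t"
    using M \<alpha> R [of j] j by (auto intro!: prod_nonneg)
  then show ?thesis
    unfolding layer_gain_def using binomial max_power
    by (intro mult_right_mono mult_mono mult_left_mono) simp_all
qed

context
  fixes P :: "('x::finite, 'c::finite) lstm" and xmax :: real and k l :: nat
    and U :: "complex^2^2" and lam1 lam2 :: real and nu :: complex
  assumes schur_A_s: "unitary U \<and> lam1 \<ge> lam2 \<and>
    cmat (A_s P xmax l k) = U ** mat2 (complex_of_real lam1) nu 0 (complex_of_real lam2) ** cadj U"
begin

lemma spec_rad_A_s: "spec_rad (A_s P xmax l k) = lam1"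
  using spec_rad_schur [OF _ _ _ A_s_trace_pos] schur_A_s by blast

lemma spec_rad_A_s_pos: "0 < spec_rad (A_s P xmax l k)"
  using schur_l1_pos [OF _ _ _ A_s_trace_pos] schur_A_s unfolding spec_rad_A_s by blast

lemma norm_funpow_A_s_le:
  "s \<le> t \<Longrightarrow> norm (((*v) (A_s P xmax l k) ^^ s) y) \<le> mu lam1 lam2 nu t * spec_rad (A_s P xmax l k) ^ s * norm y"
  using norm_funpow_schur_le [OF _ _ _ A_s_trace_pos] schur_A_s unfolding spec_rad_A_s by blast

end

lemma lstm_error_le_layer_gains:
  fixes P :: "('x::finite, 'c::finite) lstm" and x :: "nat \<Rightarrow> real^'x"
  assumes "L \<ge> 1" and "xmax > 0"
    and schur: "\<forall>l\<in>{1..L}. unitary (Ud l) \<and> lam1 l \<ge> lam2 l \<and>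
          cmat (A_s P xmax l k) = Ud l ** mat2 (complex_of_real (lam1 l)) (nu l) 0 (complex_of_real (lam2 l)) ** cadj (Ud l)"
    and S1: "\<forall>l\<in>{1..L}. s1 l \<in> Sset P xmax l k"
    and S2: "\<forall>l\<in>{1..L}. s2 l \<in> Sset P xmax l k"
    and inp: "\<forall>\<tau>\<le>t. \<forall>j. \<bar>x \<tau> $ j\<bar> \<le> xmax"
  shows "norm (traj P s1 x t L - traj P s2 x t L)
    \<le> (\<Sum>m\<in>{1..L}. layer_gain (\<lambda>i. mu (lam1 i) (lam2 i) (nu i) t) (\<lambda>i. spec_rad (A_s P xmax i k))
          (\<lambda>i. norm (a_x P xmax i k)) L m t * norm (s1 m - s2 m))"
proof -
  define M where "M i = mu (lam1 i) (lam2 i) (nu i) t" for i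
  define R where "R i = spec_rad (A_s P xmax i k)" for i
  define \<alpha> where "\<alpha> i = norm (a_x P xmax i k)" for i
  define n where "n l \<tau> = norm (traj P s1 x \<tau> l - traj P s2 x \<tau> l)" for l \<tau>
  have M_nonneg: "0 \<le> M i" for i
    unfolding M_def mu_def Let_def by simp
  have R_nonneg: "0 \<le> R l" if "l \<in> {1..L}" for l
    unfolding R_def using spec_rad_A_s_pos [OF bspec [OF schur that]] by simp
  have "n L t \<le> (\<Sum>m\<in>{1..L}. layer_gain M R \<alpha> L m t * n m 0)"
  proof (rule layered_recursion_bound [OF M_nonneg R_nonneg])
    show "n l \<tau> \<le> M l * R l ^ \<tau> * n l 0
        + (\<Sum>\<sigma>\<in>{1..\<tau>}. M l * R l ^ (\<tau> - \<sigma>) * \<alpha> l * (if l = 1 then 0 else n (l - 1) \<sigma>))"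
      if l: "l \<in> {1..L}" and "\<tau> \<le> t" for l \<tau>
      using norm_traj_diff_le_convolution [OF _ S1 S2 inp l \<open>\<tau> \<le> t\<close> norm_funpow_A_s_le [OF bspec [OF schur l]]
          M_nonneg [of l, unfolded M_def] R_nonneg [OF l, unfolded R_def]] \<open>xmax > 0\<close>
      unfolding M_def R_def \<alpha>_def n_def by simp
  qed (use \<open>L \<ge> 1\<close> in \<open>simp_all add: n_def \<alpha>_def\<close>)
  then show ?thesis
    unfolding M_def R_def \<alpha>_def n_def traj.simps(1) .
qed

lemma layer_gain_diag: "layer_gain M R \<alpha> l l \<tau> = M l * R l ^ \<tau>"
  by (simp add: layer_gain_def)

theorem proposition5p2:
  fixes P :: "('x::finite, 'c::finite) lstm"
    and L k t :: nat and xmax :: real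
    and s1 s2 :: "nat \<Rightarrow> 'c lstate"
    and x :: "nat \<Rightarrow> real^'x"
    and Ud :: "nat \<Rightarrow> complex^2^2" and lam1 lam2 :: "nat \<Rightarrow> real" and nu :: "nat \<Rightarrow> complex"
  assumes "L \<ge> 1" and "xmax > 0"
    and schur: "\<forall>l\<in>{1..L}. unitary (Ud l) \<and> lam1 l \<ge> lam2 l \<and>
          cmat (A_s P xmax l k) = Ud l ** mat2 (complex_of_real (lam1 l)) (nu l) 0 (complex_of_real (lam2 l)) ** cadj (Ud l)"
    and S1: "\<forall>l\<in>{1..L}. s1 l \<in> Sset P xmax l k"
    and S2: "\<forall>l\<in>{1..L}. s2 l \<in> Sset P xmax l k"
    and inp: "\<forall>\<tau>\<le>t. \<forall>j. \<bar>x \<tau> $ j\<bar> \<le> xmax"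
    and "t > 0"
  shows "norm (traj P s1 x t L - traj P s2 x t L)
    \<le> mu (lam1 L) (lam2 L) (nu L) t * spec_rad (A_s P xmax L k) ^ t * norm (s1 L - s2 L)
      + (\<Sum>l = 1..<L.
           (\<Prod>i = l..L. mu (lam1 i) (lam2 i) (nu i) t)
           * (fact (t + L - l) / (fact t * fact (L - l)))
           * Max ((\<lambda>i. spec_rad (A_s P xmax i k) ^ t) ` {l..L})
           * (\<Prod>i = Suc l..L. norm (a_x P xmax i k))
           * norm (s1 l - s2 l))" (is "_ \<le> ?rhs")
proof -
  let ?M = "\<lambda>i. mu (lam1 i) (lam2 i) (nu i) t" and ?R = "\<lambda>i. spec_rad (A_s P xmax i k)"
    and ?\<alpha> = "\<lambda>i. norm (a_x P xmax i k)"
  have "{1..L} = insert L {1..<L}"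
    using \<open>L \<ge> 1\<close> by auto
  then have "norm (traj P s1 x t L - traj P s2 x t L)
      \<le> ?M L * ?R L ^ t * norm (s1 L - s2 L)
        + (\<Sum>m\<in>{1..<L}. layer_gain ?M ?R ?\<alpha> L m t * norm (s1 m - s2 m))"
    using lstm_error_le_layer_gains [OF assms(1-6)] by (simp add: layer_gain_diag)
  also have "\<dots> \<le> ?rhs"
  proof -
    have "0 < ?R i" if "i \<in> {1..L}" for i
      using spec_rad_A_s_pos [OF bspec [OF schur that]] .
    then show ?thesis
      by (intro add_left_mono sum_mono mult_right_mono layer_gain_le_binomial)
        (auto simp: mu_def Let_def less_imp_le)
  qed
  finally show ?thesis .
qed

end
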